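(* Let $\omega$ be a subadditive weight, let $a\ge 1$ be real, put $p=a-1$, and let $\sigma(t)=\omega(t^{\frac1a})$ for $t\ge 0$. Let $\psi:\mathbb{R}\to\mathbb{R}$ be a $C^\infty$ function such that: (a) there is $C_0>0$ with $|x|\le C_0(1+|\psi(x)|)^a$ for every $x\in\mathbb{R}$; (b) for every $m\in\mathbb{N}$ there is $C_m>0$ such that $|\psi^{(j)}(x)|\le C_m\exp\big(m\varphi_\sigma^*(\tfrac{j}{m})\big)(1+|\psi(x)|)^p$ for all $j\in\mathbb{N}$ (i.e. $j\ge 1$) and all $x\in\mathbb{R}$. Then $f\circ\psi\in\mathcal{S}_{(\sigma)}(\mathbb{R})$ for every $f\in\mathcal{S}_{(\omega)}(\mathbb{R})$.
   Context: A weight is a continuous (weakly) increasing function $\omega:[0,\infty)\to[0,\infty)$ such that: $(\alpha)$ there is $K\ge 1$ with $\omega(2t)\le K(\omega(t)+1)$ for all $t\ge 0$; $(\beta)$ $\int_0^\infty \frac{\omega(t)}{1+t^2}\,dt<\infty$; $(\gamma)$ $\log(1+t^2)=o(\omega(t))$ as $t\to\infty$; $(\delta)$ $\varphi_\omega(t):=\omega(e^t)$ is convex on $\mathbb{R}$. It is extended to $\mathbb{R}$ by $\omega(x)=\omega(|x|)$. It is subadditive if $\omega(s+t)\le\omega(s)+\omega(t)$ for all $s,t\ge 0$. The Young conjugate is $\varphi_\omega^*(s):=\sup\{st-\varphi_\omega(t): t\ge 0\}$, $s\ge 0$ (and likewise $\varphi_\sigma^*$ for $\sigma$). For a weight $\omega$,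 the Gelfand-Shilov space $\mathcal{S}_{(\omega)}(\mathbb{R})$ consists of the (complex-valued) functions $f\in L^1(\mathbb{R})$ such that $f,\widehat f\in C^\infty(\mathbb{R})$ ($\widehat f$ the Fourier transform) and, for all $\lambda>0$ and $j\in\mathbb{N}_0$, $q_{\lambda,j}(f):=\max\big(\sup_{x\in\mathbb{R}}|f^{(j)}(x)|e^{\lambda\omega(x)},\ \sup_{\xi\in\mathbb{R}}|\widehat f^{(j)}(\xi)|e^{\lambda\omega(\xi)}\big)<\infty$. It is a Fréchet space with these seminorms. Equivalent systems of seminorms (defining the same space and topology) are $p_\lambda(f)=\sup_{j,k\in\mathbb{N}_0}\sup_{x}|x^kf^{(j)}(x)|e^{-\lambda\varphi_\omega^*(\frac{j+k}{\lambda})}$, $\lambda>0$, and $\pi_{\lambda,\mu}(f)=\sup_{j\in\mathbb{N}_0}\sup_{x}|f^{(j)}(x)|e^{-\lambda\varphi_\omega^*(\frac{j}{\lambda})+\mu\omega(x)}$, $\lambda,\mu>0$. *)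

theory Defs
  imports "HOL-Analysis.Analysis" "HOL-Library.Landau_Symbols"
begin

text \<open>
  A weight is a function on the half-line. It is represented by a total function on the reals of
  which only the values at nonnegative arguments matter; its even extension is written
  explicitly as \<open>\<omega> \<bar>x\<bar>\<close>. Since the integrand is nonnegative and continuous on the
  half-line, the integrability condition is the same as finiteness of the integral.
\<close>

definition weight :: "(real \<Rightarrow> real) \<Rightarrow> bool" where
  "weight \<omega> \<longleftrightarrow>
     continuous_on {0..} \<omega> \<and>
     mono_on {0..} \<omega> \<and>
     (\<forall>t\<ge>0. 0 \<le> \<omega> t) \<and>
     (\<exists>K\<ge>1. \<forall>t\<ge>0. \<omega> (2 * t) \<le> K * (\<omega> t + 1)) \<and>
     set_integrable lborel {0..} (\<lambda>t. \<omega> t / (1 + t\<^sup>2)) \<and>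
     (\<lambda>t. ln (1 + t\<^sup>2)) \<in> o[at_top](\<omega>) \<and>
     convex_on UNIV (\<lambda>t. \<omega> (exp t))"

definition subadditive_weight :: "(real \<Rightarrow> real) \<Rightarrow> bool" where
  "subadditive_weight \<omega> \<longleftrightarrow>
     weight \<omega> \<and> (\<forall>s\<ge>0. \<forall>t\<ge>0. \<omega> (s + t) \<le> \<omega> s + \<omega> t)"

text \<open>
  The Young conjugate of \<open>t \<mapsto> \<omega> (exp t)\<close>, for \<open>s \<ge> 0\<close>. For a weight, \<open>ln t = o(\<omega> t)\<close> makes
  the set bounded above, so the real-valued supremum is the actual one.
\<close>

definition young_conj :: "(real \<Rightarrow> real) \<Rightarrow> real \<Rightarrow> real" where
  "young_conj \<omega> s = (SUP t\<in>{0..}. s * t - \<omega> (exp t))"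

definition nderiv :: "nat \<Rightarrow> (real \<Rightarrow> 'a::real_normed_vector) \<Rightarrow> real \<Rightarrow> 'a" where
  "nderiv j f = ((\<lambda>g x. vector_derivative g (at x)) ^^ j) f"

definition smooth :: "(real \<Rightarrow> 'a::real_normed_vector) \<Rightarrow> bool" where
  "smooth f \<longleftrightarrow> (\<forall>j x. nderiv j f differentiable (at x))"

text \<open>
  The normalisation of the Fourier transform is immaterial below: by the doubling condition on
  weights, rescaling the frequency variable does not change the space \<open>gelfand_shilov \<omega>\<close>.
\<close>

definition fourier :: "(real \<Rightarrow> complex) \<Rightarrow> real \<Rightarrow> complex" where
  "fourier f \<xi> = (\<integral>x. exp (- \<i> * complex_of_real (x * \<xi>)) * f x \<partial>lborel)"

definition gs_seminorm :: "(real \<Rightarrow> real) \<Rightarrow> real \<Rightarrow> nat \<Rightarrow> (real \<Rightarrow> complex) \<Rightarrow> ennreal" where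
  "gs_seminorm \<omega> l j f =
     max (SUP x. ennreal (norm (nderiv j f x) * exp (l * \<omega> \<bar>x\<bar>)))
         (SUP \<xi>. ennreal (norm (nderiv j (fourier f) \<xi>) * exp (l * \<omega> \<bar>\<xi>\<bar>)))"

definition gelfand_shilov :: "(real \<Rightarrow> real) \<Rightarrow> (real \<Rightarrow> complex) set" where
  "gelfand_shilov \<omega> =
     {f. integrable lborel f \<and> smooth f \<and> smooth (fourier f) \<and>
         (\<forall>l>0. \<forall>j. gs_seminorm \<omega> l j f < \<infinity>)}"

end

theory Submission
  imports Defs "HOL-Probability.Characteristic_Functions" "HOL-Probability.Sinc_Integral"
begin

text \<open>
  For a weight \<open>w\<close> let \<open>M l k\<close> be the supremum of \<open>t ^ k * exp (- l * w t)\<close> over \<open>t \<ge> 0\<close>, which plays the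
  role of \<open>exp (l * \<phi>\<^sup>* (k / l))\<close>. Subadditivity gives \<open>((j + k) choose j) * M l j * M l k \<le> M l (j + k)\<close>.
  With this inequality the bound on \<open>f \<circ> \<psi>\<close> follows by induction from
  \<open>(f \<circ> \<psi>)' = \<psi>' * (f' \<circ> \<psi>)\<close> and Leibniz' rule. The constants of \<open>\<psi>\<close> depend on \<open>m\<close>, but \<open>f\<close>
  satisfies its estimates with any additional factor \<open>n ^ (- k)\<close>, so that they do not accumulate.

  For \<open>f\<close> one needs joint control of \<open>x ^ j * f\<^sup>(\<^sup>k\<^sup>)(x)\<close>: Fourier inversion bounds the derivatives, and
  partial integration in the pairings \<open>\<integral> x ^ j * f\<^sup>(\<^sup>k\<^sup>) * cnj f\<^sup>(\<^sup>l\<^sup>)\<close> combines decay with regularity. The constants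
  there must not depend on \<open>l\<close>, which uses \<open>w t = o(t)\<close>, a consequence of the integrability condition.
  The factor \<open>(1 + \<bar>\<psi>\<bar>) ^ p\<close> turns the moments of \<open>\<omega>\<close> into those of \<open>\<sigma>\<close>, and the decay of the
  Fourier transform of \<open>f \<circ> \<psi>\<close> is read off from the derivatives of \<open>f \<circ> \<psi>\<close> by minimising over their order.
\<close>

section \<open>Moments of a subadditive weight\<close>

text \<open>The seminorms of \<open>gelfand_shilov\<close> bound each derivative by a constant whose
  growth in the order is unknown. Quantitative use is made only of the decay of \<open>f\<close> and
  \<open>fourier f\<close> at order zero; the growth of the derivatives has to be extracted from it.
  Losses are paid for with the parameter of \<open>moment\<close>. A geometric factor
  \<open>n ^ k\<close> costs a passage from \<open>n * l\<close> to \<open>l\<close>, a polynomial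
  factor or an index shift costs an additive amount. So the base of a power has to be known before
  the parameter is fixed. For \<psi> this can be arranged: its constant belongs to a parameter fixed
  earlier, and \<open>f\<close> is then estimated at a larger one. In the partial integration,
  however, the natural base \<open>1 / moment l 1\<close> depends on the parameter itself, so that
  absorbing it would be circular. The locale serves for both \<omega> and \<sigma>. Its assumptions
  \<open>rapid\<close> and \<open>sublinear\<close> are the forms in which (\<gamma>) and (\<beta>)
  enter the estimates, and they pass easily from \<omega> to \<sigma>.\<close>

locale subadditive_rapid =
  fixes w :: "real \<Rightarrow> real"
  assumes nonneg: "\<And>t. t \<ge> 0 \<Longrightarrow> 0 \<le> w t"
    and mono: "\<And>s t. 0 \<le> s \<Longrightarrow> s \<le> t \<Longrightarrow> w s \<le> w t"
    and subadd: "\<And>s t. 0 \<le> s \<Longrightarrow> 0 \<le> t \<Longrightarrow> w (s + t) \<le> w s + w t"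
    and convex: "convex_on UNIV (\<lambda>t. w (exp t))"
    and rapid: "\<And>l k. l > 0 \<Longrightarrow> \<exists>B. \<forall>t\<ge>0. t ^ k * exp (- (l * w t)) \<le> B"
    and sublinear: "\<And>e. e > 0 \<Longrightarrow> \<exists>B. \<forall>t\<ge>0. w t \<le> e * t + B"
begin

text \<open>The supremum runs over all \<open>t \<ge> 0\<close>, whereas the Young conjugate
  corresponds to \<open>t \<ge> 1\<close>; hence \<open>moment\<close> dominates the exponentials in
  the hypothesis on \<psi>.\<close>

definition moment :: "real \<Rightarrow> nat \<Rightarrow> real" where
  "moment l k = (SUP t\<in>{0..}. t ^ k * exp (- (l * w t)))"

lemma moment_upper:
  assumes "l > 0" "t \<ge> 0"
  shows "t ^ k * exp (- (l * w t)) \<le> moment l k"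
proof -
  obtain B where "\<forall>t\<ge>0. t ^ k * exp (- (l * w t)) \<le> B"
    using rapid[OF assms(1)] by blast
  then have "bdd_above ((\<lambda>t. t ^ k * exp (- (l * w t))) ` {0..})"
    by (auto simp: bdd_above_def)
  then show ?thesis
    unfolding moment_def using assms(2) by (intro cSUP_upper) auto
qed

lemma moment_least: "(\<And>t. t \<ge> 0 \<Longrightarrow> t ^ k * exp (- (l * w t)) \<le> B) \<Longrightarrow> moment l k \<le> B"
  unfolding moment_def by (rule cSUP_least, simp, simp)

lemma moment_pos: "l > 0 \<Longrightarrow> 0 < moment l k"
  using less_le_trans[OF exp_gt_zero moment_upper[of l 1 k, simplified]] by simp

lemma moment_least_scaled:
  assumes "0 \<le> c" "0 \<le> B"
    and "\<And>t. t \<ge> 0 \<Longrightarrow> c * (t ^ k * exp (- (l * w t))) \<le> B"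
  shows "c * moment l k \<le> B"
proof (cases "c = 0")
  case False
  with assms have c: "c > 0" by simp
  have "moment l k \<le> B / c"
    using assms(3) c by (intro moment_least) (simp add: pos_le_divide_eq mult.commute)
  then show ?thesis using c by (simp add: pos_le_divide_eq mult.commute)
qed (use assms in auto)

text \<open>Subadditivity turns \<open>s ^ j * t ^ k\<close> into a single term of the binomial expansion of
  \<open>(s + t) ^ (j + k)\<close>.\<close>
lemma moment_mult:
  assumes "l > 0"
  shows "((j + k) choose j) * (moment l j * moment l k) \<le> moment l (j + k)"
proof -
  have pos: "0 \<le> moment l i" for i using moment_pos[OF assms, of i] by simp
  have *: "((j + k) choose j) * (s ^ j * exp (- (l * w s))) * (t ^ k * exp (- (l * w t)))
      \<le> moment l (j + k)" if "s \<ge> 0" "t \<ge> 0" for s t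
  proof -
    have "((j + k) choose j) * s ^ j * t ^ k \<le> (\<Sum>i\<le>j + k. ((j + k) choose i) * s ^ i * t ^ (j + k - i))"
      using member_le_sum[of j "{..j + k}" "\<lambda>i. ((j + k) choose i) * s ^ i * t ^ (j + k - i)"] that
      by simp
    also have "\<dots> = (s + t) ^ (j + k)" by (simp add: binomial_ring)
    finally have 1: "((j + k) choose j) * s ^ j * t ^ k \<le> (s + t) ^ (j + k)" .
    have 2: "exp (- (l * w s)) * exp (- (l * w t)) \<le> exp (- (l * w (s + t)))"
      using mult_left_mono[OF subadd[OF that], of l] assms
      by (simp add: exp_add[symmetric] distrib_left)
    have "((j + k) choose j) * s ^ j * t ^ k * (exp (- (l * w s)) * exp (- (l * w t)))
        \<le> (s + t) ^ (j + k) * exp (- (l * w (s + t)))"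
      using that by (intro mult_mono 1 2) auto
    also have "\<dots> \<le> moment l (j + k)" using that by (intro moment_upper assms) auto
    finally show ?thesis by (simp add: mult_ac)
  qed
  have **: "(((j + k) choose j) * (s ^ j * exp (- (l * w s)))) * moment l k \<le> moment l (j + k)"
    if "s \<ge> 0" for s
    using that *[of s] pos by (intro moment_least_scaled) auto
  have "(((j + k) choose j) * moment l k) * moment l j \<le> moment l (j + k)"
    using ** pos by (intro moment_least_scaled) (auto simp: mult_ac)
  then show ?thesis by (simp add: mult_ac)
qed

text \<open>The binomial coefficient in \<open>moment_mult\<close> is \<open>k + 1\<close> when the
  second index is one. It pays for the factor that arises when a power is differentiated.\<close>

lemma moment_Suc:
  assumes "l > 0"
  shows "Suc k * moment l k \<le> moment l (Suc k) / moment l 1"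
proof -
  have "((k + 1) choose k) = Suc k" by simp
  then have "real (Suc k) * (moment l k * moment l 1) \<le> moment l (Suc k)"
    using moment_mult[OF assms, of k 1] by (metis Suc_eq_plus1)
  then show ?thesis
    using moment_pos[OF assms, of 1] by (simp only: pos_le_divide_eq mult.assoc)
qed

lemma moment_le_Suc:
  assumes "l > 0"
  shows "moment l k \<le> moment l (Suc k) / moment l 1"
proof -
  have "1 * moment l k \<le> Suc k * moment l k"
    using moment_pos[OF assms, of k] by (intro mult_right_mono) auto
  then show ?thesis using moment_Suc[OF assms, of k] by simp
qed

text \<open>The expression maximised at \<open>(2 * l, 2 * k)\<close> is the square of the one at
  \<open>(l, k)\<close>, which later allows square roots to be taken in quadratic estimates.\<close>

lemma moment_double:
  assumes "l > 0"
  shows "moment (2 * l) (2 * k) \<le> (moment l k)\<^sup>2"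
proof (rule moment_least)
  fix t :: real assume t: "t \<ge> 0"
  have "t ^ (2 * k) * exp (- (2 * l * w t)) = (t ^ k * exp (- (l * w t)))\<^sup>2"
    by (simp add: power_mult_distrib power_even_eq exp_double[symmetric])
  also have "\<dots> \<le> (moment l k)\<^sup>2"
    using t by (intro power_mono moment_upper assms) auto
  finally show "t ^ (2 * k) * exp (- (2 * l * w t)) \<le> (moment l k)\<^sup>2" .
qed

text \<open>A part \<open>v\<close> of the parameter is spent on one factor \<open>t\<close>; this
  removes a shift of the index by one.\<close>

lemma moment_shift:
  assumes "l > 0" "v > 0"
  shows "moment (v + l) (Suc k) \<le> moment v 1 * moment l k"
proof (rule moment_least)
  fix t :: real assume t: "t \<ge> 0"
  have "t ^ Suc k * exp (- ((v + l) * w t)) = (t ^ 1 * exp (- (v * w t))) * (t ^ k * exp (- (l * w t)))"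
    by (simp add: distrib_right exp_add[symmetric])
  also have "\<dots> \<le> moment v 1 * moment l k"
    using t assms moment_pos[OF assms(2), of 1]
    by (intro mult_mono moment_upper) (auto simp del: power_one_right)
  finally show "t ^ Suc k * exp (- ((v + l) * w t)) \<le> moment v 1 * moment l k" .
qed

lemma moment_anti:
  assumes "0 < l" "l \<le> l'"
  shows "moment l' k \<le> moment l k"
proof (rule moment_least)
  fix t :: real assume t: "t \<ge> 0"
  have "t ^ k * exp (- (l' * w t)) \<le> t ^ k * exp (- (l * w t))"
    using t assms nonneg[OF t] by (intro mult_left_mono) (auto intro: mult_right_mono)
  also have "\<dots> \<le> moment l k" using t assms by (intro moment_upper)
  finally show "t ^ k * exp (- (l' * w t)) \<le> moment l k" .
qed

text \<open>The supporting line of \<open>t \<mapsto> w (exp t)\<close> at \<open>ln r\<close> has some slope \<open>s\<close>; the moment of order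
  \<open>\<lfloor>s\<rfloor>\<close> almost realises the infimum over all orders.\<close>
lemma decay_from_moments:
  assumes l: "l > 0" and r: "r \<ge> 0" and B: "B \<ge> 0"
    and X: "\<And>j. X * r ^ j \<le> B * moment l j"
  shows "X \<le> B * exp (l * w 1) * (1 + r) * exp (- (l * w r))"
proof (cases "r \<le> 1")
  case True
  have "moment l 0 \<le> 1" using l nonneg by (intro moment_least) auto
  then have "B * moment l 0 \<le> B * 1" using B by (rule mult_left_mono)
  then have "X \<le> B * 1" using X[of 0] by simp
  also have "\<dots> \<le> B * (exp (l * w 1 - l * w r) * (1 + r))"
  proof -
    have "l * w r \<le> l * w 1" using l mono[OF r True] by simp
    then have "1 \<le> exp (l * w 1 - l * w r)" by simp
    then have "1 * 1 \<le> exp (l * w 1 - l * w r) * (1 + r)" using r by (intro mult_mono) auto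
    then show ?thesis using B by (intro mult_left_mono) auto
  qed
  finally show ?thesis by (simp add: exp_diff exp_minus field_simps)
next
  case False
  then have r1: "r > 1" by simp
  \<comment> \<open>This is the right derivative at \<open>ln r\<close>, so that \<open>sup0\<close>
    is the supporting line there.\<close>
  define s where "s = Inf ((\<lambda>t. (w (exp (ln r)) - w (exp t)) / (ln r - t)) ` ({ln r<..} \<inter> UNIV))"
  have sup0: "w (exp y) \<ge> w (exp (ln r)) + s * (y - ln r)" for y
    unfolding s_def
    by (rule convex_le_Inf_differential[OF convex]) auto
  have s0: "s \<ge> 0"
    using sup0[of "ln r - 1"] mono[of "exp (ln r - 1)" "exp (ln r)"] by auto
  define n where "n = nat \<lfloor>l * s\<rfloor>"
  have n: "real n \<le> l * s" "l * s \<le> real n + 1"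
    using s0 l unfolding n_def by (auto simp: of_nat_nat)
  \<comment> \<open>Replacing \<open>l * s\<close> by its integer part \<open>n\<close> only helps
    for \<open>t \<ge> r\<close>, and costs at most a factor \<open>r / t \<le> r\<close> for
    \<open>1 \<le> t < r\<close>. This is the origin of the factor \<open>1 + r\<close> in the
    conclusion.\<close>
  have key: "(t / r) ^ n * exp (- (l * w t)) \<le> r * exp (- (l * w r))" if t: "t \<ge> 1" for t
  proof -
    have "l * w t \<ge> l * w r + l * s * (ln t - ln r)"
      using sup0[of "ln t"] t r1 l mult_left_mono[OF sup0[of "ln t"], of l] by (simp add: algebra_simps)
    moreover have "n * (ln t - ln r) \<le> l * s * (ln t - ln r) + ln r"
    proof (cases "t \<ge> r")
      case True
      then have "n * (ln t - ln r) \<le> l * s * (ln t - ln r)" using n r1 by (intro mult_right_mono) auto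
      then show ?thesis using ln_gt_zero[OF r1] by linarith
    next
      case False
      then have "(l * s - n) * (ln r - ln t) \<le> 1 * (ln r - ln t)" using n r1 t by (intro mult_right_mono) auto
      also have "\<dots> \<le> ln r" using t by simp
      finally show ?thesis by (simp add: algebra_simps)
    qed
    ultimately have "n * (ln t - ln r) - l * w t \<le> ln r - l * w r" by linarith
    then have "exp (n * (ln t - ln r) - l * w t) \<le> exp (ln r - l * w r)" by simp
    moreover have "exp (n * (ln t - ln r)) = (t / r) ^ n"
      using t r1 by (simp add: exp_of_nat_mult exp_diff)
    moreover have "exp (n * (ln t - ln r) - l * w t) = exp (n * (ln t - ln r)) * exp (- (l * w t))"
      by (simp only: exp_add[symmetric] diff_conv_add_uminus)
    moreover have "exp (ln r - l * w r) = r * exp (- (l * w r))"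
      using r1 by (simp add: exp_diff exp_minus divide_inverse)
    ultimately show ?thesis by simp
  qed
  \<comment> \<open>Below \<open>t = 1\<close> the left side is compared with its value at 1: the
    power increases, and the weight is dropped at the cost of \<open>exp (l * w 1)\<close>.\<close>
  have key': "(t / r) ^ n * exp (- (l * w t)) \<le> exp (l * w 1) * (r * exp (- (l * w r)))"
    if t: "t \<ge> 0" for t
  proof (cases "t \<ge> 1")
    case True
    have "1 * (r * exp (- (l * w r))) \<le> exp (l * w 1) * (r * exp (- (l * w r)))"
      using l nonneg[of 1] r by (intro mult_right_mono) auto
    then show ?thesis using key[OF True] by simp
  next
    case False
    have "(t / r) ^ n * exp (- (l * w t)) \<le> (1 / r) ^ n * 1"
      using t r l False nonneg[OF t] by (intro mult_mono power_mono divide_right_mono) auto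
    also have "\<dots> = exp (l * w 1) * ((1 / r) ^ n * exp (- (l * w 1)))" by (simp add: exp_minus)
    also have "\<dots> \<le> exp (l * w 1) * (r * exp (- (l * w r)))"
      using key[of 1] by (intro mult_left_mono) auto
    finally show ?thesis .
  qed
  have "(1 / r ^ n) * moment l n \<le> exp (l * w 1) * (r * exp (- (l * w r)))"
    using r key' by (intro moment_least_scaled) (auto simp: power_divide)
  then have "B * ((1 / r ^ n) * moment l n) \<le> B * (exp (l * w 1) * (r * exp (- (l * w r))))"
    using B by (rule mult_left_mono)
  moreover have "X \<le> B * ((1 / r ^ n) * moment l n)"
    using X[of n] r1 by (simp add: field_simps)
  moreover have "B * (exp (l * w 1) * (r * exp (- (l * w r)))) \<le> B * (exp (l * w 1) * ((1 + r) * exp (- (l * w r))))"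
    using B by (intro mult_left_mono mult_right_mono) auto
  ultimately show ?thesis by (simp add: mult_ac)
qed

lemma subadd_nat: "t \<ge> 0 \<Longrightarrow> n \<ge> 1 \<Longrightarrow> w (real n * t) \<le> real n * w t"
proof (induction n)
  case (Suc n)
  then show ?case
    using subadd[of t "real n * t"] by (cases "n = 0") (auto simp: algebra_simps)
qed simp

text \<open>Substituting \<open>n * t\<close> for \<open>t\<close> and using
  \<open>w (n * t) \<le> n * w t\<close> trades a factor \<open>n\<close> of the parameter for
  \<open>n ^ k\<close>. Geometric constants are absorbed in this way.\<close>

lemma moment_scale:
  assumes l: "l > 0" and n: "n \<ge> 1"
  shows "real n ^ k * moment (real n * l) k \<le> moment l k"
proof (rule moment_least_scaled)
  show "0 \<le> moment l k" using moment_pos[OF l] by (rule less_imp_le)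
  fix t :: real assume t: "t \<ge> 0"
  have "l * w (real n * t) \<le> real n * l * w t"
    using mult_left_mono[OF subadd_nat[OF t n], of l] l by (simp add: mult_ac)
  then have "(real n * t) ^ k * exp (- (real n * l * w t)) \<le> (real n * t) ^ k * exp (- (l * w (real n * t)))"
    using t by (intro mult_left_mono) auto
  also have "\<dots> \<le> moment l k" using t l by (intro moment_upper) auto
  finally show "real n ^ k * (t ^ k * exp (- (real n * l * w t))) \<le> moment l k"
    by (simp only: power_mult_distrib mult.assoc)
qed simp

lemma fact_le_moment:
  assumes l: "l > 0"
  obtains K where "K > 0" "\<And>n. fact n \<le> K * moment l n"
proof -
  obtain B where B: "\<And>t. t \<ge> 0 \<Longrightarrow> w t \<le> exp (- 1) / l * t + B"
    using sublinear[of "exp (- 1) / l"] l by auto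
  have "fact n \<le> exp (l * B) * moment l n" for n
  proof -
    \<comment> \<open>At this point the power is \<open>n ^ n * exp n\<close>, and the slope
      \<open>exp (- 1) / l\<close> of the linear bound makes the exponential lose exactly
      \<open>exp n\<close>, up to a constant.\<close>
    let ?t = "real n * exp 1"
    have "l * w ?t \<le> l * (exp (- 1) / l * ?t + B)" using B[of ?t] l by (intro mult_left_mono) auto
    also have "\<dots> = real n + l * B" using l by (simp add: algebra_simps flip: exp_add)
    finally have w: "l * w ?t \<le> real n + l * B" .
    have "fact n \<le> real n ^ n" using fact_le_power[of n, where 'a = real] by simp
    also have "\<dots> = exp (l * B) * (?t ^ n * exp (- (real n + l * B)))"
      by (simp add: power_mult_distrib exp_of_nat_mult[symmetric] flip: exp_add)
    also have "\<dots> \<le> exp (l * B) * (?t ^ n * exp (- (l * w ?t)))"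
      using w by (intro mult_left_mono) auto
    also have "\<dots> \<le> exp (l * B) * moment l n"
      using l by (intro mult_left_mono moment_upper) auto
    finally show ?thesis .
  qed
  then show thesis using that[of "exp (l * B)"] by simp
qed

text \<open>The sequence \<open>n! * (\<Sum>i\<le>n. moment l i / i!)\<close> is comparable to the moments up to \<open>2 ^ n\<close>, and
  its growth condition \<open>n * m (n - 1) \<le> m n\<close> has a constant that does not depend on \<open>l\<close>.\<close>
lemma moment_majorant:
  assumes l: "l > 0"
  obtains m K where "K > 0" "\<And>n. moment l n \<le> m n" "\<And>n. m n \<le> K * 2 ^ n * moment l n"
    "\<And>n. real n * m (n - 1) \<le> m n" "\<And>n. m n \<le> m (Suc n)"
proof -
  obtain K where K: "K > 0" "\<And>n. fact n \<le> K * moment l n" using fact_le_moment[OF l] by blast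
  have M: "0 < moment l n" for n using moment_pos[OF l] .
  define m where "m = (\<lambda>n. fact n * (\<Sum>i\<le>n. moment l i / fact i))"
  have m0: "0 \<le> m n" for n unfolding m_def using M by (intro mult_nonneg_nonneg sum_nonneg) (auto intro: less_imp_le)
  \<comment> \<open>Both growth conditions on \<open>m\<close> follow from this recursion with
    constant one; for \<open>moment\<close> the corresponding inequalities carry
    \<open>1 / moment l 1\<close>.\<close>
  have Suc: "m (Suc n) = real (Suc n) * m n + moment l (Suc n)" for n
    by (simp add: m_def distrib_left del: of_nat_Suc)
  have 0: "m 0 = moment l 0" by (simp add: m_def)
  have "m n \<le> K * 2 ^ n * moment l n" for n
  proof -
    have "m n = (\<Sum>i\<le>n. fact n * (moment l i / fact i))" by (simp add: m_def sum_distrib_left)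
    also have "\<dots> \<le> (\<Sum>i\<le>n. K * moment l n)"
    proof (rule sum_mono)
      fix i assume "i \<in> {..n}"
      then have i: "i \<le> n" by simp
      \<comment> \<open>Bounding the remaining factorial \<open>fact (n - i)\<close> by a moment
        makes \<open>moment_mult\<close> applicable, binomial coefficient included.\<close>
      have "fact n * (moment l i / fact i) = real (n choose i) * (moment l i * fact (n - i))"
        using i by (simp add: binomial_fact)
      also have "\<dots> \<le> real (n choose i) * (moment l i * (K * moment l (n - i)))"
        using M[of i] by (intro mult_left_mono K) auto
      also have "\<dots> = K * (real (n choose i) * (moment l i * moment l (n - i)))" by simp
      also have "\<dots> \<le> K * moment l n"
        using moment_mult[OF l, of i "n - i"] i K(1) by (intro mult_left_mono) auto
      finally show "fact n * (moment l i / fact i) \<le> K * moment l n" .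
    qed
    also have "\<dots> = real (n + 1) * (K * moment l n)" by simp
    also have "\<dots> \<le> 2 ^ n * (K * moment l n)"
    proof (rule mult_right_mono)
      have "n + 1 \<le> 2 ^ n" using Suc_leI[OF less_exp[of n]] by simp
      then show "real (n + 1) \<le> 2 ^ n" by (metis of_nat_le_iff of_nat_numeral of_nat_power)
    qed (use K(1) M[of n] in auto)
    finally show ?thesis by (simp only: mult_ac)
  qed
  moreover have "moment l n \<le> m n" for n using Suc 0 m0 by (cases n) auto
  moreover have "real n * m (n - 1) \<le> m n" for n
  proof (cases n)
    case (Suc i)
    then show ?thesis using \<open>\<And>n. m (Suc n) = _\<close>[of i] M[of n] by simp
  qed (use m0 in simp)
  moreover have "m n \<le> m (Suc n)" for n
  proof -
    have "1 * m n \<le> real (Suc n) * m n" using m0 by (intro mult_right_mono) auto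
    then show ?thesis using Suc[of n] M[of "Suc n"] by simp
  qed
  ultimately show thesis using that[of K m] K(1) by blast
qed

lemma rapid_shifted:
  assumes "l > 0"
  obtains B where "B > 0" "\<And>t. t \<ge> 0 \<Longrightarrow> (1 + t) ^ k * exp (- (l * w t)) \<le> B"
proof -
  define B where "B = exp (l * w 1) * moment l k"
  have "(1 + t) ^ k * exp (- (l * w t)) \<le> B" if t: "t \<ge> 0" for t
  proof -
    have "l * w (1 + t) \<le> l * w 1 + l * w t"
      using subadd[of 1 t] t assms by (metis distrib_left less_imp_le mult_left_mono zero_le_one)
    then have "exp (- (l * w t)) \<le> exp (l * w 1 - l * w (1 + t))" by simp
    then have "exp (- (l * w t)) \<le> exp (l * w 1) * exp (- (l * w (1 + t)))"
      by (simp add: exp_diff exp_minus field_simps)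
    then have "(1 + t) ^ k * exp (- (l * w t)) \<le> (1 + t) ^ k * (exp (l * w 1) * exp (- (l * w (1 + t))))"
      using t by (intro mult_left_mono) auto
    also have "\<dots> = exp (l * w 1) * ((1 + t) ^ k * exp (- (l * w (1 + t))))" by simp
    also have "\<dots> \<le> B" unfolding B_def using t assms by (intro mult_left_mono moment_upper) auto
    finally show ?thesis .
  qed
  moreover have "B > 0" unfolding B_def using moment_pos[OF assms] by simp
  ultimately show ?thesis using that by blast
qed

end

section \<open>Iterated derivatives\<close>

lemma nderiv_0 [simp]: "nderiv 0 f = f"
  by (simp add: nderiv_def)

lemma nderiv_Suc: "nderiv (Suc n) f x = vector_derivative (nderiv n f) (at x)"
  by (simp add: nderiv_def)

lemma nderiv_nderiv: "nderiv m (nderiv k f) = nderiv (m + k) f"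
  by (simp add: nderiv_def funpow_add)

lemma nderiv_1: "nderiv (Suc 0) f = (\<lambda>x. vector_derivative f (at x))"
  by (simp add: nderiv_def)

lemma smooth_has_vector_derivative:
  "smooth f \<Longrightarrow> (nderiv n f has_vector_derivative nderiv (Suc n) f x) (at x)"
  unfolding smooth_def nderiv_Suc by (simp add: vector_derivative_works)

text \<open>Closed forms for all derivatives are checked with one differentiation rule for a
  candidate sequence \<open>F\<close>; this serves for products with \<open>x\<close>, for Fourier
  transforms and for the inversion formula.\<close>

lemma nderiv_unique:
  assumes "\<And>n x. (F n has_vector_derivative F (Suc n) x) (at x)"
  shows "nderiv n (F 0) = F n"
proof (induction n)
  case (Suc n)
  show ?case
    using vector_derivative_at[OF assms] by (auto simp: nderiv_Suc Suc.IH)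
qed simp

lemma smoothI:
  assumes "\<And>n x. (F n has_vector_derivative F (Suc n) x) (at x)"
  shows "smooth (F 0)"
  unfolding smooth_def nderiv_unique[of F, OF assms]
  using assms differentiableI_vector by blast

lemma smooth_nderiv: "smooth f \<Longrightarrow> smooth (nderiv k f)"
  unfolding smooth_def nderiv_nderiv by blast

lemma smooth_nderiv_continuous: "smooth f \<Longrightarrow> continuous_on UNIV (nderiv k f)"
  unfolding smooth_def
  by (meson continuous_at_imp_continuous_on differentiable_imp_continuous_within)

section \<open>Leibniz' rule and the chain rule for iterated derivatives\<close>

lemma sum_binomial_pascal:
  fixes G :: "nat \<Rightarrow> 'a::real_vector"
  shows "(\<Sum>i\<le>m. real (m choose i) *\<^sub>R (G i + G (Suc i))) = (\<Sum>i\<le>Suc m. real (Suc m choose i) *\<^sub>R G i)"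
proof -
  have "(\<Sum>i\<le>Suc m. real (Suc m choose i) *\<^sub>R G i)
      = G 0 + (\<Sum>i\<le>m. real (m choose Suc i) *\<^sub>R G (Suc i)) + (\<Sum>i\<le>m. real (m choose i) *\<^sub>R G (Suc i))"
    by (subst sum.atMost_Suc_shift) (simp add: scaleR_left_distrib sum.distrib add_ac)
  also have "G 0 + (\<Sum>i\<le>m. real (m choose Suc i) *\<^sub>R G (Suc i)) = (\<Sum>i\<le>Suc m. real (m choose i) *\<^sub>R G i)"
    by (subst sum.atMost_Suc_shift) simp
  also have "\<dots> = (\<Sum>i\<le>m. real (m choose i) *\<^sub>R G i)" by simp
  finally show ?thesis by (simp add: scaleR_right_distrib sum.distrib)
qed

text \<open>Smoothness of a composition is obtained by induction on the order: the derivative of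
  \<open>f \<circ> \<psi>\<close> contains a composition with the derivative of \<open>f\<close>,
  which is known to be differentiable to one order less. The finite order makes this induction
  possible.\<close>

definition diff_upto :: "nat \<Rightarrow> (real \<Rightarrow> 'a::real_normed_vector) \<Rightarrow> bool" where
  "diff_upto n f \<longleftrightarrow> (\<forall>j<n. \<forall>x. nderiv j f differentiable (at x))"

lemma smooth_iff_diff_upto: "smooth f \<longleftrightarrow> (\<forall>n. diff_upto n f)"
  unfolding smooth_def diff_upto_def by blast

lemma diff_upto_has_vector_derivative:
  "diff_upto n f \<Longrightarrow> j < n \<Longrightarrow> (nderiv j f has_vector_derivative nderiv (Suc j) f x) (at x)"
  unfolding diff_upto_def nderiv_Suc by (simp add: vector_derivative_works)

lemma diff_upto_SucI:
  assumes "\<And>x. (f has_vector_derivative f' x) (at x)" and "diff_upto n f'"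
  shows "diff_upto (Suc n) f"
proof -
  have 1: "nderiv (Suc 0) f = f'"
    using vector_derivative_at[OF assms(1)] by (simp add: nderiv_1 fun_eq_iff)
  show ?thesis unfolding diff_upto_def
  proof (intro allI impI)
    fix j x assume "j < Suc n"
    show "nderiv j f differentiable (at x)"
    proof (cases j)
      case 0
      then show ?thesis using differentiableI_vector[OF assms(1)] by simp
    next
      case (Suc i)
      then have "nderiv j f = nderiv i f'" using nderiv_nderiv[of i "Suc 0" f] 1 by simp
      then show ?thesis using assms(2) Suc \<open>j < Suc n\<close> by (simp add: diff_upto_def)
    qed
  qed
qed

lemma leibniz_has_vector_derivative:
  fixes u :: "real \<Rightarrow> real" and v :: "real \<Rightarrow> 'a::real_normed_vector"
  assumes "diff_upto n u" "diff_upto n v" "m < n"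
  shows "((\<lambda>x. \<Sum>i\<le>m. real (m choose i) *\<^sub>R (nderiv (m - i) u x *\<^sub>R nderiv i v x)) has_vector_derivative
      (\<Sum>i\<le>Suc m. real (Suc m choose i) *\<^sub>R (nderiv (Suc m - i) u x *\<^sub>R nderiv i v x))) (at x)"
proof -
  let ?G = "\<lambda>i. nderiv (Suc m - i) u x *\<^sub>R nderiv i v x"
  have "((\<lambda>x. \<Sum>i\<le>m. real (m choose i) *\<^sub>R (nderiv (m - i) u x *\<^sub>R nderiv i v x)) has_vector_derivative
      (\<Sum>i\<le>m. real (m choose i) *\<^sub>R (?G i + ?G (Suc i)))) (at x)"
  proof (rule has_vector_derivative_sum)
    fix i assume i: "i \<in> {..m}"
    have "(nderiv (m - i) u has_vector_derivative nderiv (Suc m - i) u x) (at x)"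
      using diff_upto_has_vector_derivative[OF assms(1), of "m - i"] assms(3) i by (simp add: Suc_diff_le)
    moreover have "(nderiv i v has_vector_derivative nderiv (Suc i) v x) (at x)"
      using diff_upto_has_vector_derivative[OF assms(2)] assms(3) i by simp
    ultimately have "((\<lambda>x. nderiv (m - i) u x *\<^sub>R nderiv i v x) has_vector_derivative (?G (Suc i) + ?G i)) (at x)"
      using has_vector_derivative_scaleR[of "nderiv (m - i) u" _ x UNIV "nderiv i v"]
      by (simp add: has_real_derivative_iff_has_vector_derivative)
    then have "((\<lambda>x. real (m choose i) *\<^sub>R (nderiv (m - i) u x *\<^sub>R nderiv i v x)) has_vector_derivative
      real (m choose i) *\<^sub>R (?G (Suc i) + ?G i)) (at x)"
      by (rule bounded_linear.has_vector_derivative[OF bounded_linear_scaleR_right])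
    then show "((\<lambda>x. real (m choose i) *\<^sub>R (nderiv (m - i) u x *\<^sub>R nderiv i v x)) has_vector_derivative
      real (m choose i) *\<^sub>R (?G i + ?G (Suc i))) (at x)"
      by (simp add: add.commute)
  qed
  then show ?thesis using sum_binomial_pascal[of m ?G] by (simp only:)
qed

lemma nderiv_scaleR:
  fixes u :: "real \<Rightarrow> real" and v :: "real \<Rightarrow> 'a::real_normed_vector"
  assumes "diff_upto n u" "diff_upto n v" "m \<le> n"
  shows "nderiv m (\<lambda>x. u x *\<^sub>R v x) =
    (\<lambda>x. \<Sum>i\<le>m. real (m choose i) *\<^sub>R (nderiv (m - i) u x *\<^sub>R nderiv i v x))"
  using assms(3)
proof (induction m)
  case (Suc m)
  show ?case
  proof
    fix x
    have "nderiv m (\<lambda>x. u x *\<^sub>R v x) =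
        (\<lambda>x. \<Sum>i\<le>m. real (m choose i) *\<^sub>R (nderiv (m - i) u x *\<^sub>R nderiv i v x))"
      using Suc by simp
    then show "nderiv (Suc m) (\<lambda>x. u x *\<^sub>R v x) x =
        (\<Sum>i\<le>Suc m. real (Suc m choose i) *\<^sub>R (nderiv (Suc m - i) u x *\<^sub>R nderiv i v x))"
      using vector_derivative_at[OF leibniz_has_vector_derivative[OF assms(1,2), of m x]] Suc.prems
      by (simp only: nderiv_Suc Suc_le_lessD)
  qed
qed simp

lemma diff_upto_scaleR:
  fixes u :: "real \<Rightarrow> real" and v :: "real \<Rightarrow> 'a::real_normed_vector"
  assumes "diff_upto n u" "diff_upto n v"
  shows "diff_upto n (\<lambda>x. u x *\<^sub>R v x)"
  unfolding diff_upto_def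
  using nderiv_scaleR[OF assms] leibniz_has_vector_derivative[OF assms] differentiableI_vector
  by (metis (no_types, lifting) less_imp_le)

lemma has_vector_derivative_compose_smooth:
  assumes "smooth \<psi>" "smooth f"
  shows "((f \<circ> \<psi>) has_vector_derivative nderiv 1 \<psi> x *\<^sub>R (nderiv 1 f \<circ> \<psi>) x) (at x)"
  using vector_diff_chain_at[OF smooth_has_vector_derivative[OF assms(1), of 0]
      smooth_has_vector_derivative[OF assms(2), of 0]] by simp

lemma diff_upto_compose:
  assumes "smooth \<psi>" "smooth f"
  shows "diff_upto n (f \<circ> \<psi>)"
  using assms(2)
proof (induction n arbitrary: f)
  case (Suc n)
  have "diff_upto n (\<lambda>x. nderiv 1 \<psi> x *\<^sub>R (nderiv 1 f \<circ> \<psi>) x)"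
    using Suc.IH[OF smooth_nderiv[OF Suc.prems, of 1]] smooth_nderiv[OF assms(1), of 1]
    by (intro diff_upto_scaleR) (auto simp: smooth_iff_diff_upto)
  then show ?case
    using has_vector_derivative_compose_smooth[OF assms(1) Suc.prems] by (rule diff_upto_SucI[rotated])
qed (simp add: diff_upto_def)

lemma smooth_compose: "smooth \<psi> \<Longrightarrow> smooth f \<Longrightarrow> smooth (f \<circ> \<psi>)"
  by (simp add: diff_upto_compose smooth_iff_diff_upto)

text \<open>Leibniz' rule is applied to the first derivative only. The composition with the
  derivative of \<open>f\<close> stays unexpanded, so that an estimate can be proved by
  recursion.\<close>

lemma nderiv_Suc_compose:
  assumes "smooth \<psi>" "smooth f"
  shows "nderiv (Suc n) (f \<circ> \<psi>) x =
    (\<Sum>i\<le>n. real (n choose i) *\<^sub>R (nderiv (Suc (n - i)) \<psi> x *\<^sub>R nderiv i (nderiv 1 f \<circ> \<psi>) x))"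
proof -
  have "nderiv 1 (f \<circ> \<psi>) = (\<lambda>x. nderiv 1 \<psi> x *\<^sub>R (nderiv 1 f \<circ> \<psi>) x)"
    using vector_derivative_at[OF has_vector_derivative_compose_smooth[OF assms]]
    by (simp add: nderiv_1 fun_eq_iff)
  then have "nderiv (Suc n) (f \<circ> \<psi>) = nderiv n (\<lambda>x. nderiv 1 \<psi> x *\<^sub>R (nderiv 1 f \<circ> \<psi>) x)"
    using nderiv_nderiv[of n 1 "f \<circ> \<psi>"] by simp
  also have "\<dots> = (\<lambda>x. \<Sum>i\<le>n. real (n choose i) *\<^sub>R
      (nderiv (n - i) (nderiv 1 \<psi>) x *\<^sub>R nderiv i (nderiv 1 f \<circ> \<psi>) x))"
    using smooth_nderiv[OF assms(1), of 1] smooth_compose[OF assms(1) smooth_nderiv[OF assms(2), of 1]]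
    by (intro nderiv_scaleR[of n "nderiv 1 \<psi>" "nderiv 1 f \<circ> \<psi>" n])
      (simp_all only: smooth_iff_diff_upto)
  finally show ?thesis by (simp add: nderiv_nderiv)
qed

lemma smooth_times_id:
  fixes g :: "real \<Rightarrow> complex"
  assumes "smooth g"
  shows "smooth (\<lambda>x. x *\<^sub>R g x)"
    and "nderiv n (\<lambda>x. x *\<^sub>R g x) = (\<lambda>x. x *\<^sub>R nderiv n g x + real n *\<^sub>R nderiv (n - 1) g x)"
proof -
  \<comment> \<open>For \<open>n = 0\<close> the truncated index \<open>n - 1\<close> is 0, but its
    coefficient vanishes.\<close>
  define F where "F = (\<lambda>n x. x *\<^sub>R nderiv n g x + real n *\<^sub>R nderiv (n - 1) g x)"
  have F: "(F n has_vector_derivative F (Suc n) x) (at x)" for n x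
  proof (cases n)
    case 0
    then show ?thesis unfolding F_def
      by (auto intro!: derivative_eq_intros smooth_has_vector_derivative[OF assms, of 0, simplified])
  next
    case (Suc m)
    then show ?thesis unfolding F_def
      by (auto intro!: derivative_eq_intros smooth_has_vector_derivative[OF assms]
          simp: algebra_simps scaleR_conv_of_real)
  qed
  have F0: "F 0 = (\<lambda>x. x *\<^sub>R g x)" by (simp add: F_def)
  show "smooth (\<lambda>x. x *\<^sub>R g x)" using smoothI[of F, OF F] F0 by simp
  show "nderiv n (\<lambda>x. x *\<^sub>R g x) = (\<lambda>x. x *\<^sub>R nderiv n g x + real n *\<^sub>R nderiv (n - 1) g x)"
    using nderiv_unique[of F, OF F] F0 unfolding F_def by simp
qed

section \<open>Decaying functions and the Fourier transform\<close>

lemma integrable_inverse_1_plus_square_lborel: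
  "integrable lborel (\<lambda>x::real. B * inverse (1 + x\<^sup>2))"
  using integrable_inverse_1_plus_square by (simp add: set_integrable_def)

lemma integral_inverse_1_plus_square_lborel:
  "(\<integral>x. B * inverse (1 + x\<^sup>2) \<partial>lborel) = B * (pi :: real)"
  using LBINT_inverse_1_plus_square
  by (simp add: interval_lebesgue_integral_def set_lebesgue_integral_def)

lemma le_inverse_1_plus_square:
  fixes u x B :: real
  assumes "u * (1 + x\<^sup>2) \<le> B"
  shows "u \<le> B * inverse (1 + x\<^sup>2)"
proof -
  have "0 < 1 + x\<^sup>2" by (simp add: add_pos_nonneg)
  then show ?thesis using assms by (simp add: divide_inverse[symmetric] pos_le_divide_eq)
qed

text \<open>Decay is measured against \<open>1 + x\<^sup>2\<close> because its reciprocal is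
  integrable with integral \<open>pi\<close>.\<close>

lemma
  fixes h :: "real \<Rightarrow> 'a::{banach, second_countable_topology}"
  assumes "continuous_on UNIV h" and "\<And>x. norm (h x) * (1 + x\<^sup>2) \<le> B"
  shows decay_integrable: "integrable lborel h"
    and decay_integral_norm: "(\<integral>x. norm (h x) \<partial>lborel) \<le> B * pi"
proof -
  have le: "norm (h x) \<le> B * inverse (1 + x\<^sup>2)" for x
    using le_inverse_1_plus_square[OF assms(2)] .
  have "h \<in> borel_measurable borel" using assms(1) by (rule borel_measurable_continuous_onI)
  then show i: "integrable lborel h"
    by (intro Bochner_Integration.integrable_bound[OF integrable_inverse_1_plus_square_lborel[of B]])
      (auto intro!: AE_I2 order_trans[OF le])
  show "(\<integral>x. norm (h x) \<partial>lborel) \<le> B * pi"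
    unfolding integral_inverse_1_plus_square_lborel[symmetric]
    using i le by (intro Bochner_Integration.integral_mono integrable_norm integrable_inverse_1_plus_square_lborel)
qed

lemma decay_tendsto_0:
  fixes F :: "real \<Rightarrow> 'a::real_normed_vector"
  assumes "\<And>x. norm (F x) * (1 + x\<^sup>2) \<le> A" and "filterlim X at_infinity sequentially"
  shows "(\<lambda>n. F (X n)) \<longlonglongrightarrow> 0"
proof (rule tendsto_norm_zero_cancel, rule tendsto_sandwich[OF _ _ tendsto_const])
  show "\<forall>\<^sub>F n in sequentially. norm (F (X n)) \<le> A * inverse (1 + (X n)\<^sup>2)"
    using le_inverse_1_plus_square[OF assms(1)] by simp
  have "filterlim (\<lambda>n. norm (X n)) at_top sequentially"
    using assms(2) by (rule filterlim_compose[OF filterlim_norm_at_top])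
  then have "filterlim (\<lambda>n. 1 + (norm (X n))\<^sup>2) at_top sequentially"
    by (intro filterlim_tendsto_add_at_top[OF tendsto_const] filterlim_pow_at_top) auto
  then have "(\<lambda>n. inverse (1 + (norm (X n))\<^sup>2)) \<longlonglongrightarrow> 0"
    by (rule filterlim_compose[OF tendsto_inverse_0_at_top, rotated]) (rule filterlim_ident)
  then show "(\<lambda>n. A * inverse (1 + (X n)\<^sup>2)) \<longlonglongrightarrow> 0"
    by (auto intro!: tendsto_mult_right_zero)
qed auto

text \<open>The fundamental theorem of calculus is applied on \<open>{- n..n}\<close>, respectively
  \<open>{- n..y}\<close>, and \<open>n\<close> tends to infinity: the boundary values disappear by
  the decay of \<open>F\<close>, and the integrals are controlled by that of
  \<open>norm (F' x)\<close>.\<close>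

lemma
  fixes F F' :: "real \<Rightarrow> 'a::euclidean_space"
  assumes F: "\<And>x. (F has_vector_derivative F' x) (at x)"
    and cont: "continuous_on UNIV F'"
    and A: "\<And>x. norm (F x) * (1 + x\<^sup>2) \<le> A"
    and B: "\<And>x. norm (F' x) * (1 + x\<^sup>2) \<le> B"
  shows integral_derivative_eq_0: "(\<integral>x. F' x \<partial>lborel) = 0"
    and norm_le_integral_derivative: "norm (F y) \<le> (\<integral>x. norm (F' x) \<partial>lborel)"
proof -
  have int: "integrable lborel F'" using decay_integrable[OF cont B] .
  have meas: "F' \<in> borel_measurable borel" using cont by (rule borel_measurable_continuous_onI)
  have FTC: "(\<integral>x. indicator {a..b} x *\<^sub>R F' x \<partial>lborel) = F b - F a" if "a \<le> b" for a b
    using that F cont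
    by (intro integral_FTC_atLeastAtMost)
      (auto intro: has_vector_derivative_at_within continuous_on_subset)
  have right: "filterlim (\<lambda>n. real n) at_infinity sequentially"
    by (rule filterlim_mono[OF filterlim_real_sequentially at_top_le_at_infinity order_refl])
  have left: "filterlim (\<lambda>n. - real n) at_infinity sequentially"
    by (rule filterlim_mono[OF _ at_bot_le_at_infinity order_refl])
      (simp add: filterlim_uminus_at_bot filterlim_real_sequentially)
  have "(\<lambda>n. (\<integral>x. indicator {- real n..real n} x *\<^sub>R F' x \<partial>lborel)) \<longlonglongrightarrow> (\<integral>x. F' x \<partial>lborel)"
  proof (rule integral_dominated_convergence[where w = "\<lambda>x. norm (F' x)"])
    show "AE x in lborel. (\<lambda>n. indicator {- real n..real n} x *\<^sub>R F' x) \<longlonglongrightarrow> F' x"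
    proof (rule AE_I2)
      fix x :: real
      obtain N :: nat where N: "\<bar>x\<bar> \<le> real N" using real_arch_simple by blast
      have "\<forall>\<^sub>F n in sequentially. indicator {- real n..real n} x *\<^sub>R F' x = F' x"
        unfolding eventually_sequentially
      proof (intro exI allI impI)
        fix n assume "N \<le> n"
        then have "\<bar>x\<bar> \<le> real n" using N by linarith
        then show "indicator {- real n..real n} x *\<^sub>R F' x = F' x" by (auto simp: indicator_def)
      qed
      then show "(\<lambda>n. indicator {- real n..real n} x *\<^sub>R F' x) \<longlonglongrightarrow> F' x"
        by (rule tendsto_eventually)
    qed
  qed (use int meas in \<open>auto simp: indicator_def\<close>)
  moreover have "(\<lambda>n. (\<integral>x. indicator {- real n..real n} x *\<^sub>R F' x \<partial>lborel)) \<longlonglongrightarrow> 0 - 0"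
    using tendsto_diff[OF decay_tendsto_0[OF A right] decay_tendsto_0[OF A left]] by (simp add: FTC)
  ultimately show "(\<integral>x. F' x \<partial>lborel) = 0" using LIMSEQ_unique by fastforce
  have "(\<lambda>n. norm (F y - F (- real n))) \<longlonglongrightarrow> norm (F y - 0)"
    by (intro tendsto_intros decay_tendsto_0[OF A left])
  moreover have "\<forall>\<^sub>F n in sequentially. norm (F y - F (- real n)) \<le> (\<integral>x. norm (F' x) \<partial>lborel)"
    unfolding eventually_sequentially
  proof (intro exI allI impI)
    fix n assume "nat \<lceil>- y\<rceil> \<le> n"
    then have le: "- real n \<le> y" by linarith
    have "norm (F y - F (- real n)) = norm (\<integral>x. indicator {- real n..y} x *\<^sub>R F' x \<partial>lborel)"
      using FTC[OF le] by simp
    also have "\<dots> \<le> (\<integral>x. norm (F' x) \<partial>lborel)"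
      using int meas
      by (intro Bochner_Integration.integral_norm_bound_integral integrable_norm integrable_mult_indicator)
        (auto simp: indicator_def)
    finally show "norm (F y - F (- real n)) \<le> (\<integral>x. norm (F' x) \<partial>lborel)" .
  qed
  ultimately show "norm (F y) \<le> (\<integral>x. norm (F' x) \<partial>lborel)"
    using tendsto_upperbound by fastforce
qed

section \<open>Exchange of differentiation and multiplication under the Fourier transform\<close>

lemma norm_fourier_kernel [simp]: "norm (exp (- \<i> * complex_of_real (x * \<xi>))) = 1"
  by (simp add: norm_exp_eq_Re)

lemma continuous_fourier_kernel: "continuous_on UNIV (\<lambda>x. exp (- \<i> * complex_of_real (x * \<xi>)))"
  by (intro continuous_intros)

lemma integrable_fourier_kernel:
  assumes "integrable lborel h"
  shows "integrable lborel (\<lambda>x. exp (- \<i> * complex_of_real (x * \<xi>)) * h x)"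
  using assms borel_measurable_continuous_onI[OF continuous_fourier_kernel]
  by (intro Bochner_Integration.integrable_bound[OF assms]) (auto simp: norm_mult)

lemma norm_fourier_le: "norm (fourier h \<xi>) \<le> (\<integral>x. norm (h x) \<partial>lborel)"
  unfolding fourier_def
  by (rule order_trans[OF integral_norm_bound]) (simp add: norm_mult)

text \<open>The second order Taylor remainder of the exponential bounds the error of the difference
  quotient by \<open>\<bar>\<eta> - \<xi>\<bar>\<close> times the integral of
  \<open>x\<^sup>2 * norm (h x)\<close>, which is where \<open>h2\<close> enters.\<close>

lemma fourier_has_vector_derivative:
  assumes h0: "integrable lborel h"
    and h1: "integrable lborel (\<lambda>x. x *\<^sub>R h x)"
    and h2: "integrable lborel (\<lambda>x. x\<^sup>2 *\<^sub>R h x)"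
  shows "(fourier h has_vector_derivative fourier (\<lambda>x. - \<i> * (x *\<^sub>R h x)) \<xi>) (at \<xi>)"
  unfolding has_vector_derivative_def
proof (rule has_derivativeI_sandwich[of 1])
  let ?e = "\<lambda>x \<xi>. exp (- \<i> * complex_of_real (x * \<xi>))"
  let ?K = "\<integral>x. norm (x\<^sup>2 *\<^sub>R h x) \<partial>lborel"
  have quad: "u ^ Suc 1 / fact (Suc 1) \<le> u\<^sup>2" for u :: real
  proof -
    have "u ^ Suc 1 / fact (Suc 1) = u\<^sup>2 / 2" by (simp add: power2_eq_square)
    moreover have "0 \<le> u\<^sup>2" by simp
    ultimately show ?thesis by linarith
  qed
  have h1': "integrable lborel (\<lambda>x. - \<i> * (x *\<^sub>R h x))" using h1 by (rule integrable_mult_right)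
  fix \<eta> :: real assume "\<eta> \<noteq> \<xi>"
  have "fourier h \<eta> - fourier h \<xi> - (\<eta> - \<xi>) *\<^sub>R fourier (\<lambda>x. - \<i> * (x *\<^sub>R h x)) \<xi>
      = (\<integral>x. ?e x \<eta> * h x - ?e x \<xi> * h x - (\<eta> - \<xi>) *\<^sub>R (?e x \<xi> * (- \<i> * (x *\<^sub>R h x))) \<partial>lborel)"
    unfolding fourier_def using integrable_fourier_kernel[OF h0] integrable_fourier_kernel[OF h1']
    by (simp only: Bochner_Integration.integral_diff Bochner_Integration.integrable_diff
        integral_scaleR_right integrable_scaleR_right)
  also have "norm \<dots> \<le> (\<integral>x. \<bar>\<eta> - \<xi>\<bar>\<^sup>2 * norm (x\<^sup>2 *\<^sub>R h x) \<partial>lborel)"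
  proof (rule Bochner_Integration.integral_norm_bound_integral)
    show "integrable lborel (\<lambda>x. \<bar>\<eta> - \<xi>\<bar>\<^sup>2 * norm (x\<^sup>2 *\<^sub>R h x))"
      using h2 by (intro integrable_mult_right integrable_norm)
    show "integrable lborel (\<lambda>x. ?e x \<eta> * h x - ?e x \<xi> * h x - (\<eta> - \<xi>) *\<^sub>R (?e x \<xi> * (- \<i> * (x *\<^sub>R h x))))"
      using integrable_fourier_kernel[OF h0] integrable_fourier_kernel[OF h1']
      by (intro Bochner_Integration.integrable_diff integrable_scaleR_right)
    fix x :: real
    have "?e x \<eta> = ?e x \<xi> * iexp (- (x * (\<eta> - \<xi>)))"
      by (simp add: exp_add[symmetric] algebra_simps)
    then have "?e x \<eta> * h x - ?e x \<xi> * h x - (\<eta> - \<xi>) *\<^sub>R (?e x \<xi> * (- \<i> * (x *\<^sub>R h x)))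
      = ?e x \<xi> * (iexp (- (x * (\<eta> - \<xi>))) - (\<Sum>k\<le>1. (\<i> * (- (x * (\<eta> - \<xi>)))) ^ k / fact k)) * h x"
      by (simp add: scaleR_conv_of_real algebra_simps)
    also have "norm \<dots> = norm (iexp (- (x * (\<eta> - \<xi>))) - (\<Sum>k\<le>1. (\<i> * (- (x * (\<eta> - \<xi>)))) ^ k / fact k)) * norm (h x)"
      by (simp only: norm_mult norm_fourier_kernel mult_1_left)
    also have "\<dots> \<le> \<bar>- (x * (\<eta> - \<xi>))\<bar> ^ Suc 1 / fact (Suc 1) * norm (h x)"
      using iexp_approx1[of "- (x * (\<eta> - \<xi>))" 1] by (intro mult_right_mono) auto
    also have "\<dots> \<le> \<bar>- (x * (\<eta> - \<xi>))\<bar> ^ 2 * norm (h x)"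
      by (intro mult_right_mono quad) simp
    also have "\<dots> = \<bar>\<eta> - \<xi>\<bar>\<^sup>2 * norm (x\<^sup>2 *\<^sub>R h x)"
      by (simp add: power_mult_distrib)
    finally show "norm (?e x \<eta> * h x - ?e x \<xi> * h x - (\<eta> - \<xi>) *\<^sub>R (?e x \<xi> * (- \<i> * (x *\<^sub>R h x))))
        \<le> \<bar>\<eta> - \<xi>\<bar>\<^sup>2 * norm (x\<^sup>2 *\<^sub>R h x)" .
  qed
  also have "\<dots> = \<bar>\<eta> - \<xi>\<bar>\<^sup>2 * ?K" by simp
  finally show "norm (fourier h \<eta> - fourier h \<xi> - (\<eta> - \<xi>) *\<^sub>R fourier (\<lambda>x. - \<i> * (x *\<^sub>R h x)) \<xi>)
      / norm (\<eta> - \<xi>) \<le> \<bar>\<eta> - \<xi>\<bar> * ?K"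
    using \<open>\<eta> \<noteq> \<xi>\<close> by (simp add: pos_divide_le_eq power2_eq_square mult_ac)
next
  have "((\<lambda>\<eta>. \<bar>\<eta> - \<xi>\<bar> * (\<integral>x. norm (x\<^sup>2 *\<^sub>R h x) \<partial>lborel)) \<longlongrightarrow>
      \<bar>\<xi> - \<xi>\<bar> * (\<integral>x. norm (x\<^sup>2 *\<^sub>R h x) \<partial>lborel)) (at \<xi>)"
    by (intro tendsto_intros)
  then show "((\<lambda>\<eta>. \<bar>\<eta> - \<xi>\<bar> * (\<integral>x. norm (x\<^sup>2 *\<^sub>R h x) \<partial>lborel)) \<longlongrightarrow> 0) (at \<xi>)" by simp
qed (auto intro: bounded_linear_scaleR_left)

lemma
  assumes "\<And>k. integrable lborel (\<lambda>x. x ^ k *\<^sub>R h x)"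
  shows smooth_fourier: "smooth (fourier h)"
    and nderiv_fourier: "nderiv n (fourier h) = fourier (\<lambda>x. (- \<i>) ^ n * (x ^ n *\<^sub>R h x))"
proof -
  define F where "F = (\<lambda>n. fourier (\<lambda>x. (- \<i>) ^ n * (x ^ n *\<^sub>R h x)))"
  have F: "(F n has_vector_derivative F (Suc n) x) (at x)" for n x
  proof -
    let ?h = "\<lambda>x. (- \<i>) ^ n * (x ^ n *\<^sub>R h x)"
    have *: "integrable lborel (\<lambda>x. x ^ k *\<^sub>R ?h x)" for k
    proof -
      have "(\<lambda>x. x ^ k *\<^sub>R ?h x) = (\<lambda>x. (- \<i>) ^ n * (x ^ (k + n) *\<^sub>R h x))"
        by (simp add: power_add fun_eq_iff)
      then show ?thesis using assms[of "k + n"] by (simp only: integrable_mult_right)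
    qed
    have "(fourier ?h has_vector_derivative fourier (\<lambda>x. - \<i> * (x *\<^sub>R ?h x)) x) (at x)"
      using *[of 0] *[of 1] *[of 2] by (intro fourier_has_vector_derivative) simp_all
    moreover have "(\<lambda>x. - \<i> * (x *\<^sub>R ?h x)) = (\<lambda>x. (- \<i>) ^ Suc n * (x ^ Suc n *\<^sub>R h x))"
      by (simp add: fun_eq_iff mult_ac)
    ultimately show ?thesis by (simp only: F_def)
  qed
  have "F 0 = fourier h" by (simp add: F_def)
  then show "smooth (fourier h)" "nderiv n (fourier h) = fourier (\<lambda>x. (- \<i>) ^ n * (x ^ n *\<^sub>R h x))"
    using smoothI[of F, OF F] nderiv_unique[of F, OF F] by (simp_all add: F_def)
qed

text \<open>Partial integration without boundary terms: the derivative of the kernel times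
  \<open>nderiv n g\<close> integrates to zero.\<close>

lemma fourier_nderiv:
  assumes "smooth g" and B: "\<And>n x. norm (nderiv n g x) * (1 + x\<^sup>2) \<le> B n"
  shows "fourier (nderiv n g) \<xi> = (\<i> * \<xi>) ^ n * fourier g \<xi>"
proof (induction n)
  case (Suc n)
  let ?e = "\<lambda>x. exp (- \<i> * complex_of_real (x * \<xi>))"
  let ?F' = "\<lambda>x. ?e x * nderiv (Suc n) g x - (\<i> * \<xi>) * (?e x * nderiv n g x)"
  have int: "integrable lborel (\<lambda>x. ?e x * nderiv k g x)" for k
    by (rule integrable_fourier_kernel[OF decay_integrable[OF smooth_nderiv_continuous[OF assms(1)] B]])
  have "(\<integral>x. ?F' x \<partial>lborel) = 0"
  proof (rule integral_derivative_eq_0)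
    fix x :: real
    have "(?e has_vector_derivative (- \<i> * \<xi>) * ?e x) (at x)"
    proof -
      have "((\<lambda>z. exp (- \<i> * \<xi> * z)) has_field_derivative (- \<i> * \<xi>) * exp (- \<i> * \<xi> * of_real x)) (at (of_real x))"
        by (auto intro!: derivative_eq_intros)
      from has_vector_derivative_real_field[OF this] show ?thesis by (simp add: mult_ac)
    qed
    then show "((\<lambda>x. ?e x * nderiv n g x) has_vector_derivative ?F' x) (at x)"
      by (auto intro!: derivative_eq_intros smooth_has_vector_derivative[OF assms(1)])
    show "norm (?e x * nderiv n g x) * (1 + x\<^sup>2) \<le> B n"
      using B[of n x] by (simp add: norm_mult)
    have "norm (?F' x) \<le> norm (nderiv (Suc n) g x) + \<bar>\<xi>\<bar> * norm (nderiv n g x)"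
      by (rule order_trans[OF norm_triangle_ineq4]) (simp add: norm_mult)
    then have "norm (?F' x) * (1 + x\<^sup>2) \<le>
        (norm (nderiv (Suc n) g x) + \<bar>\<xi>\<bar> * norm (nderiv n g x)) * (1 + x\<^sup>2)"
      by (rule mult_right_mono) simp
    also have "\<dots> = norm (nderiv (Suc n) g x) * (1 + x\<^sup>2) + \<bar>\<xi>\<bar> * (norm (nderiv n g x) * (1 + x\<^sup>2))"
      by (simp add: algebra_simps)
    also have "\<dots> \<le> B (Suc n) + \<bar>\<xi>\<bar> * B n"
      by (intro add_mono mult_left_mono B) simp
    finally show "norm (?F' x) * (1 + x\<^sup>2) \<le> B (Suc n) + \<bar>\<xi>\<bar> * B n" .
  next
    show "continuous_on UNIV ?F'"
      by (intro continuous_intros smooth_nderiv_continuous[OF assms(1)])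
  qed
  then have "fourier (nderiv (Suc n) g) \<xi> = (\<i> * \<xi>) * fourier (nderiv n g) \<xi>"
    using int[of n] int[of "Suc n"] unfolding fourier_def
    by (subst (asm) Bochner_Integration.integral_diff) auto
  then show ?case using Suc by simp
qed simp

section \<open>Fourier inversion\<close>

lemma has_bochner_integral_gaussian:
  "has_bochner_integral lborel (\<lambda>u::real. exp (- u\<^sup>2 / 2)) (sqrt (2 * pi))"
proof -
  have eq: "(\<lambda>u::real. exp (- u\<^sup>2 / 2)) = (\<lambda>u. sqrt (2 * pi) * std_normal_density u)"
    by (simp add: std_normal_density_def fun_eq_iff)
  have "has_bochner_integral lborel std_normal_density 1"
    by (simp add: has_bochner_integral_iff)
  from has_bochner_integral_mult_right[OF this, of "sqrt (2 * pi)"] show ?thesis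
    by (simp only: eq mult_1_right)
qed

lemma gaussian_fourier:
  "(\<integral>u. exp (- u\<^sup>2 / 2) *\<^sub>R iexp (t * u) \<partial>lborel) = complex_of_real (sqrt (2 * pi) * exp (- t\<^sup>2 / 2))"
proof -
  have "(\<integral>u. std_normal_density u *\<^sub>R iexp (t * u) \<partial>lborel) = complex_of_real (exp (- t\<^sup>2 / 2))"
    using fun_cong[OF char_std_normal_distribution, of t] unfolding char_def
    by (subst (asm) integral_density) auto
  moreover have "(\<lambda>u::real. exp (- u\<^sup>2 / 2) *\<^sub>R iexp (t * u))
      = (\<lambda>u. sqrt (2 * pi) *\<^sub>R (std_normal_density u *\<^sub>R iexp (t * u)))"
    by (simp add: std_normal_density_def fun_eq_iff)
  ultimately show ?thesis by (simp only: integral_scaleR_right) (simp add: scaleR_conv_of_real)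
qed

lemma gaussian_fourier_scaled:
  assumes "c > 0"
  shows "(\<integral>\<eta>. exp (- (\<eta> / c)\<^sup>2 / 2) *\<^sub>R iexp (s * \<eta>) \<partial>lborel) =
    complex_of_real (c * sqrt (2 * pi) * exp (- (c * s)\<^sup>2 / 2))"
proof -
  have "(\<integral>\<eta>. exp (- (\<eta> / c)\<^sup>2 / 2) *\<^sub>R iexp (s * \<eta>) \<partial>lborel)
      = \<bar>c\<bar> *\<^sub>R (\<integral>u. exp (- ((0 + c * u) / c)\<^sup>2 / 2) *\<^sub>R iexp (s * (0 + c * u)) \<partial>lborel)"
    using assms by (intro lborel_integral_real_affine) simp
  also have "\<dots> = c *\<^sub>R (\<integral>u. exp (- u\<^sup>2 / 2) *\<^sub>R iexp ((c * s) * u) \<partial>lborel)"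
    using assms by (simp add: mult_ac)
  finally show ?thesis by (simp only: gaussian_fourier) (simp add: scaleR_conv_of_real)
qed

text \<open>The Gaussian factor makes the double integral absolutely convergent, and integrating it in
  the two orders gives the Gaussian regularisations of both sides of the inversion formula.\<close>
lemma fourier_gaussian_regularised:
  assumes f: "integrable lborel f" and c: "c > 0"
  shows "(\<integral>\<eta>. exp (- (\<eta> / c)\<^sup>2 / 2) *\<^sub>R (iexp (x * \<eta>) * fourier f \<eta>) \<partial>lborel) =
    sqrt (2 * pi) *\<^sub>R (\<integral>z. exp (- z\<^sup>2 / 2) *\<^sub>R f (x + z / c) \<partial>lborel)"
proof -
  let ?K = "\<lambda>y \<eta>. exp (- (\<eta> / c)\<^sup>2 / 2) *\<^sub>R (iexp ((x - y) * \<eta>) * f y)"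
  have [measurable]: "f \<in> borel_measurable borel" using f by auto
  have gauss: "integrable lborel (\<lambda>\<eta>. exp (- (\<eta> / c)\<^sup>2 / 2))"
  proof -
    have "integrable lborel (\<lambda>u::real. exp (- u\<^sup>2 / 2))"
      using has_bochner_integral_gaussian by (rule integrable.intros)
    from lborel_integrable_real_affine[OF this, of "1 / c" 0] c show ?thesis by simp
  qed
  have norm_K: "norm (?K y \<eta>) = exp (- (\<eta> / c)\<^sup>2 / 2) * norm (f y)" for y \<eta>
    by (simp add: norm_mult norm_exp_eq_Re)
  have "integrable (lborel \<Otimes>\<^sub>M lborel) (case_prod ?K)"
  proof (rule lborel_pair.Fubini_integrable)
    show "case_prod ?K \<in> borel_measurable (lborel \<Otimes>\<^sub>M lborel)" by measurable
    have "(\<lambda>y. \<integral>\<eta>. norm (case (y, \<eta>) of (y, \<eta>) \<Rightarrow> ?K y \<eta>) \<partial>lborel)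
        = (\<lambda>y. (\<integral>\<eta>. exp (- (\<eta> / c)\<^sup>2 / 2) \<partial>lborel) * norm (f y))"
      by (simp only: prod.case norm_K integral_mult_left_zero)
    then show "integrable lborel (\<lambda>y. \<integral>\<eta>. norm (case (y, \<eta>) of (y, \<eta>) \<Rightarrow> ?K y \<eta>) \<partial>lborel)"
      using f by (simp only:) (intro integrable_mult_right integrable_norm)
    show "AE y in lborel. integrable lborel (\<lambda>\<eta>. case (y, \<eta>) of (y, \<eta>) \<Rightarrow> ?K y \<eta>)"
    proof (rule AE_I2)
      fix y :: real
      have "integrable lborel (\<lambda>\<eta>. exp (- (\<eta> / c)\<^sup>2 / 2) * norm (f y))"
        using gauss by (rule integrable_mult_left)
      then have "integrable lborel (?K y)"
      proof (rule Bochner_Integration.integrable_bound)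
        show "?K y \<in> borel_measurable lborel" by measurable
        show "AE \<eta> in lborel. norm (?K y \<eta>) \<le> norm (exp (- (\<eta> / c)\<^sup>2 / 2) * norm (f y))"
          unfolding norm_K real_norm_def by (intro AE_I2 abs_ge_self)
      qed
      then show "integrable lborel (\<lambda>\<eta>. case (y, \<eta>) of (y, \<eta>) \<Rightarrow> ?K y \<eta>)" by simp
    qed
  qed
  then have swap: "(\<integral>\<eta>. (\<integral>y. ?K y \<eta> \<partial>lborel) \<partial>lborel) = (\<integral>y. (\<integral>\<eta>. ?K y \<eta> \<partial>lborel) \<partial>lborel)"
    by (rule lborel_pair.Fubini_integral)
  have 1: "(\<integral>y. ?K y \<eta> \<partial>lborel) = exp (- (\<eta> / c)\<^sup>2 / 2) *\<^sub>R (iexp (x * \<eta>) * fourier f \<eta>)" for \<eta>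
  proof -
    have "?K y \<eta> = exp (- (\<eta> / c)\<^sup>2 / 2) *\<^sub>R (iexp (x * \<eta>) * (exp (- \<i> * complex_of_real (y * \<eta>)) * f y))" for y
    proof -
      have "iexp ((x - y) * \<eta>) = iexp (x * \<eta>) * exp (- \<i> * complex_of_real (y * \<eta>))"
        by (simp add: exp_add[symmetric] algebra_simps)
      then show ?thesis by (simp only: mult.assoc)
    qed
    then show ?thesis unfolding fourier_def
      by (simp only: integral_scaleR_right integral_mult_right_zero)
  qed
  \<comment> \<open>Integration over \<eta> leaves a Gaussian in \<open>y\<close> of width
    \<open>1 / c\<close> around \<open>x\<close>, which is an approximate identity for large
    \<open>c\<close>.\<close>
  have 2: "(\<integral>\<eta>. ?K y \<eta> \<partial>lborel) = (c * sqrt (2 * pi) * exp (- (c * (x - y))\<^sup>2 / 2)) *\<^sub>R f y" for y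
  proof -
    have "?K y \<eta> = (exp (- (\<eta> / c)\<^sup>2 / 2) *\<^sub>R iexp ((x - y) * \<eta>)) * f y" for \<eta> by simp
    then show ?thesis
      by (simp only: integral_mult_left_zero gaussian_fourier_scaled[OF c]) (simp add: scaleR_conv_of_real)
  qed
  have "(\<integral>y. (c * sqrt (2 * pi) * exp (- (c * (x - y))\<^sup>2 / 2)) *\<^sub>R f y \<partial>lborel)
    = \<bar>1 / c\<bar> *\<^sub>R (\<integral>z. (c * sqrt (2 * pi) * exp (- (c * (x - (x + 1 / c * z)))\<^sup>2 / 2)) *\<^sub>R f (x + 1 / c * z) \<partial>lborel)"
    using c by (intro lborel_integral_real_affine) simp
  also have "\<dots> = sqrt (2 * pi) *\<^sub>R (\<integral>z. exp (- z\<^sup>2 / 2) *\<^sub>R f (x + z / c) \<partial>lborel)"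
  proof -
    have "(\<lambda>z. (c * sqrt (2 * pi) * exp (- (c * (x - (x + 1 / c * z)))\<^sup>2 / 2)) *\<^sub>R f (x + 1 / c * z))
        = (\<lambda>z. (c * sqrt (2 * pi)) *\<^sub>R (exp (- z\<^sup>2 / 2) *\<^sub>R f (x + z / c)))"
      using c by (simp add: fun_eq_iff)
    then show ?thesis using c by (simp only: integral_scaleR_right) simp
  qed
  finally show ?thesis using swap by (simp only: 1 2)
qed

text \<open>With \<open>c = Suc n\<close> both sides of the regularised identity converge by
  dominated convergence, the left because \<open>fourier f\<close> is integrable, the right because
  \<open>f\<close> is bounded and continuous.\<close>

theorem fourier_inversion:
  assumes f: "integrable lborel f" and cont: "continuous_on UNIV f"
    and bounded: "\<And>x. norm (f x) \<le> B"
    and fhat: "integrable lborel (fourier f)"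
  shows "fourier (fourier f) (- x) = (2 * pi) *\<^sub>R f x"
proof -
  have [measurable]: "f \<in> borel_measurable borel" using f by auto
  have [measurable]: "fourier f \<in> borel_measurable borel" using fhat by auto
  let ?L = "\<lambda>n::nat. \<integral>\<eta>. exp (- (\<eta> / real (Suc n))\<^sup>2 / 2) *\<^sub>R (iexp (x * \<eta>) * fourier f \<eta>) \<partial>lborel"
  let ?R = "\<lambda>n::nat. \<integral>z. exp (- z\<^sup>2 / 2) *\<^sub>R f (x + z / real (Suc n)) \<partial>lborel"
  have lim: "(\<lambda>n. u / real (Suc n)) \<longlonglongrightarrow> 0" for u :: real
    using tendsto_mult_right_zero[OF LIMSEQ_inverse_real_of_nat, of u] by (simp add: divide_inverse)
  have L: "?L \<longlonglongrightarrow> (\<integral>\<eta>. iexp (x * \<eta>) * fourier f \<eta> \<partial>lborel)"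
  proof (rule integral_dominated_convergence[where w = "\<lambda>\<eta>. norm (fourier f \<eta>)"])
    show "AE \<eta> in lborel. (\<lambda>n. exp (- (\<eta> / real (Suc n))\<^sup>2 / 2) *\<^sub>R (iexp (x * \<eta>) * fourier f \<eta>))
        \<longlonglongrightarrow> iexp (x * \<eta>) * fourier f \<eta>"
    proof (rule AE_I2)
      fix \<eta> :: real
      have "(\<lambda>n. exp (- (\<eta> / real (Suc n))\<^sup>2 / 2) *\<^sub>R (iexp (x * \<eta>) * fourier f \<eta>))
          \<longlonglongrightarrow> exp (- 0\<^sup>2 / 2) *\<^sub>R (iexp (x * \<eta>) * fourier f \<eta>)"
        by (intro tendsto_intros lim) simp
      then show "(\<lambda>n. exp (- (\<eta> / real (Suc n))\<^sup>2 / 2) *\<^sub>R (iexp (x * \<eta>) * fourier f \<eta>))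
          \<longlonglongrightarrow> iexp (x * \<eta>) * fourier f \<eta>" by simp
    qed
    show "AE \<eta> in lborel. norm (exp (- (\<eta> / real (Suc n))\<^sup>2 / 2) *\<^sub>R (iexp (x * \<eta>) * fourier f \<eta>)) \<le> norm (fourier f \<eta>)" for n
      by (intro AE_I2) (simp add: norm_mult norm_exp_eq_Re mult_left_le_one_le)
    show "integrable lborel (\<lambda>\<eta>. norm (fourier f \<eta>))" using fhat by simp
  qed measurable
  have R: "?R \<longlonglongrightarrow> (\<integral>z. exp (- z\<^sup>2 / 2) *\<^sub>R f x \<partial>lborel)"
  proof (rule integral_dominated_convergence[where w = "\<lambda>z. exp (- z\<^sup>2 / 2) * B"])
    show "AE z in lborel. (\<lambda>n. exp (- z\<^sup>2 / 2) *\<^sub>R f (x + z / real (Suc n))) \<longlonglongrightarrow> exp (- z\<^sup>2 / 2) *\<^sub>R f x"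
    proof (rule AE_I2)
      fix z :: real
      have "isCont f x" using cont by (simp add: continuous_on_eq_continuous_at)
      moreover have "(\<lambda>n. x + z / real (Suc n)) \<longlonglongrightarrow> x"
        using tendsto_add[OF tendsto_const lim, of x z] by simp
      ultimately have "(\<lambda>n. f (x + z / real (Suc n))) \<longlonglongrightarrow> f x" by (rule isCont_tendsto_compose)
      then show "(\<lambda>n. exp (- z\<^sup>2 / 2) *\<^sub>R f (x + z / real (Suc n))) \<longlonglongrightarrow> exp (- z\<^sup>2 / 2) *\<^sub>R f x"
        by (intro tendsto_intros)
    qed
    show "integrable lborel (\<lambda>z. exp (- z\<^sup>2 / 2) * B)"
      using has_bochner_integral_gaussian by (intro integrable_mult_left) (rule integrable.intros)
    show "AE z in lborel. norm (exp (- z\<^sup>2 / 2) *\<^sub>R f (x + z / real (Suc n))) \<le> exp (- z\<^sup>2 / 2) * B" for n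
      using bounded by (intro AE_I2) simp
  qed measurable
  have "(\<lambda>n. sqrt (2 * pi) *\<^sub>R ?R n) \<longlonglongrightarrow> sqrt (2 * pi) *\<^sub>R (\<integral>z. exp (- z\<^sup>2 / 2) *\<^sub>R f x \<partial>lborel)"
    by (intro tendsto_intros R)
  moreover have "?L = (\<lambda>n. sqrt (2 * pi) *\<^sub>R ?R n)"
    using fourier_gaussian_regularised[OF f] by (simp only: of_nat_0_less_iff zero_less_Suc)
  ultimately have "?L \<longlonglongrightarrow> sqrt (2 * pi) *\<^sub>R (\<integral>z. exp (- z\<^sup>2 / 2) *\<^sub>R f x \<partial>lborel)"
    by (simp only:)
  with L have "(\<integral>\<eta>. iexp (x * \<eta>) * fourier f \<eta> \<partial>lborel)
      = sqrt (2 * pi) *\<^sub>R (\<integral>z. exp (- z\<^sup>2 / 2) *\<^sub>R f x \<partial>lborel)"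
    by (rule LIMSEQ_unique)
  also have "(\<integral>z. exp (- z\<^sup>2 / 2) *\<^sub>R f x \<partial>lborel) = sqrt (2 * pi) *\<^sub>R f x"
    using has_bochner_integral_gaussian
    by (intro has_bochner_integral_integral_eq has_bochner_integral_scaleR_left)
  also have "(\<integral>\<eta>. iexp (x * \<eta>) * fourier f \<eta> \<partial>lborel) = fourier (fourier f) (- x)"
    unfolding fourier_def[of "fourier f"] by (simp add: mult.commute)
  finally show ?thesis by simp
qed

section \<open>Mixed estimates for Gelfand-Shilov functions\<close>

context subadditive_rapid
begin

text \<open>The exponent \<open>l + 1\<close> is split: one unit absorbs
  \<open>1 + x\<^sup>2\<close>, and \<open>l\<close> remains for the moment. \<open>D\<close>
  depends neither on \<open>B\<close> nor on \<open>n\<close>.\<close>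

lemma weight_decay:
  fixes h :: "real \<Rightarrow> 'a::real_normed_vector"
  assumes "l > 0"
  obtains D where "D > 0"
    "\<And>x B n. norm (h x) * exp ((l + 1) * w \<bar>x\<bar>) \<le> B \<Longrightarrow>
      norm (x ^ n *\<^sub>R h x) * (1 + x\<^sup>2) \<le> B * D * moment l n"
proof -
  obtain D where D: "D > 0" "\<And>t. t \<ge> 0 \<Longrightarrow> (1 + t) ^ 2 * exp (- (1 * w t)) \<le> D"
    using rapid_shifted[of 1 2] by auto
  have "norm (x ^ n *\<^sub>R h x) * (1 + x\<^sup>2) \<le> B * D * moment l n"
    if B: "norm (h x) * exp ((l + 1) * w \<bar>x\<bar>) \<le> B" for x B n
  proof -
    have B0: "0 \<le> B" by (rule order_trans[OF _ B]) simp
    have le: "1 + x\<^sup>2 \<le> (1 + \<bar>x\<bar>) ^ 2" by (simp add: power2_sum)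
    define E where "E = exp ((l + 1) * w \<bar>x\<bar>)"
    define E1 where "E1 = exp (- (1 * w \<bar>x\<bar>))"
    define E2 where "E2 = exp (- (l * w \<bar>x\<bar>))"
    have 1: "E * E1 * E2 = 1"
      unfolding E_def E1_def E2_def by (simp add: exp_add[symmetric] algebra_simps)
    have "norm (x ^ n *\<^sub>R h x) * (1 + x\<^sup>2) = (\<bar>x\<bar> ^ n * norm (h x)) * (1 + x\<^sup>2) * (E * E1 * E2)"
      unfolding 1 by (simp add: power_abs)
    also have "\<dots> = (norm (h x) * E) * (((1 + x\<^sup>2) * E1) * (\<bar>x\<bar> ^ n * E2))"
      by (simp only: mult_ac)
    finally have "norm (x ^ n *\<^sub>R h x) * (1 + x\<^sup>2) = (norm (h x) * exp ((l + 1) * w \<bar>x\<bar>)) *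
        (((1 + x\<^sup>2) * exp (- (1 * w \<bar>x\<bar>))) * (\<bar>x\<bar> ^ n * exp (- (l * w \<bar>x\<bar>))))"
      unfolding E_def E1_def E2_def .
    also have "\<dots> \<le> B * (D * moment l n)"
    proof (intro mult_mono B moment_upper assms)
      have "(1 + x\<^sup>2) * exp (- (1 * w \<bar>x\<bar>)) \<le> (1 + \<bar>x\<bar>) ^ 2 * exp (- (1 * w \<bar>x\<bar>))"
        using le by (intro mult_right_mono) auto
      also have "\<dots> \<le> D" using D(2)[of "\<bar>x\<bar>"] by simp
      finally show "(1 + x\<^sup>2) * exp (- (1 * w \<bar>x\<bar>)) \<le> D" .
    qed (use B0 D in auto)
    finally show ?thesis by (simp add: mult_ac)
  qed
  with D(1) show thesis by (rule that)
qed

text \<open>By inversion \<open>f\<close> is, up to reflection and a factor, the Fourier transform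
  of \<open>fourier f\<close>. Its derivatives are therefore bounded by the integrals of
  \<open>norm (\<xi> ^ k *\<^sub>R fourier f \<xi>)\<close>, and these by moments.\<close>

lemma nderiv_le_moment:
  assumes l: "l > 0"
    and f: "integrable lborel f" "continuous_on UNIV f" "\<And>x. norm (f x) \<le> B0"
    and h: "continuous_on UNIV (fourier f)" "\<And>\<xi>. norm (fourier f \<xi>) * exp ((l + 1) * w \<bar>\<xi>\<bar>) \<le> B"
  obtains C where "C \<ge> 0" "\<And>k x. norm (nderiv k f x) \<le> C * moment l k"
proof -
  obtain D where D: "D > 0"
    "\<And>\<xi> n. norm (\<xi> ^ n *\<^sub>R fourier f \<xi>) * (1 + \<xi>\<^sup>2) \<le> B * D * moment l n"
    using weight_decay[OF l, of "fourier f"] h(2) by metis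
  have B0: "0 \<le> B"
    using order_trans[OF _ h(2)[of 0]] by simp
  have cont: "continuous_on UNIV (\<lambda>\<xi>. \<xi> ^ n *\<^sub>R fourier f \<xi>)" for n
    using h(1) by (intro continuous_intros)
  have int: "integrable lborel (\<lambda>\<xi>. \<xi> ^ n *\<^sub>R fourier f \<xi>)" for n
    using decay_integrable[OF cont D(2)] .
  have inv: "f x = (1 / (2 * pi)) *\<^sub>R fourier (fourier f) (- x)" for x
    using fourier_inversion[OF f, of x] int[of 0] by simp
  let ?g = "fourier (fourier f)"
  define F where "F = (\<lambda>k x. (1 / (2 * pi)) *\<^sub>R ((- 1) ^ k *\<^sub>R nderiv k ?g (- x)))"
  have F: "(F k has_vector_derivative F (Suc k) x) (at x)" for k x
  proof -
    have "(uminus has_vector_derivative - 1) (at x)" for x :: real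
      by (auto intro!: derivative_eq_intros)
    from vector_diff_chain_at[OF this smooth_has_vector_derivative[OF smooth_fourier[OF int]]]
    have "((\<lambda>x. nderiv k ?g (- x)) has_vector_derivative - nderiv (Suc k) ?g (- x)) (at x)"
      by (simp add: o_def)
    then have "(F k has_vector_derivative (1 / (2 * pi)) *\<^sub>R ((- 1) ^ k *\<^sub>R (- nderiv (Suc k) ?g (- x)))) (at x)"
      unfolding F_def by (intro bounded_linear.has_vector_derivative[OF bounded_linear_scaleR_right])
    then show ?thesis by (simp add: F_def)
  qed
  have "F 0 = f" using inv by (simp add: F_def fun_eq_iff)
  then have nd: "nderiv k f = F k" for k using nderiv_unique[of F, OF F] by simp
  show thesis
  proof (rule that[of "B * D * pi"])
    show "B * D * pi \<ge> 0" using B0 D by simp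
    fix k x
    have "norm (nderiv k f x) = 1 / (2 * pi) * norm (nderiv k ?g (- x))"
      by (simp add: nd F_def power_abs)
    also have "\<dots> \<le> 1 * norm (nderiv k ?g (- x))"
      using pi_gt3 by (intro mult_right_mono) auto
    also have "\<dots> \<le> (\<integral>\<xi>. norm (\<xi> ^ k *\<^sub>R fourier f \<xi>) \<partial>lborel)"
      using norm_fourier_le[of "\<lambda>\<xi>. (- \<i>) ^ k * (\<xi> ^ k *\<^sub>R fourier f \<xi>)" "- x"]
      by (simp add: nderiv_fourier[OF int] norm_mult norm_power)
    also have "\<dots> \<le> B * D * moment l k * pi"
      by (rule decay_integral_norm[OF cont D(2)])
    finally show "norm (nderiv k f x) \<le> B * D * pi * moment l k" by (simp add: mult_ac)
  qed
qed

end

text \<open>The weighted \<open>L\<^sup>2\<close> pairings of derivatives are moved to \<open>l = 0\<close> by partial integration.\<close>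
definition pairing :: "(real \<Rightarrow> complex) \<Rightarrow> nat \<Rightarrow> nat \<Rightarrow> nat \<Rightarrow> complex" where
  "pairing f j k l = (\<integral>x. x ^ j *\<^sub>R (nderiv k f x * cnj (nderiv l f x)) \<partial>lborel)"

locale schwartz_function =
  fixes f :: "real \<Rightarrow> complex"
  assumes smooth: "smooth f"
    and poly_decay: "\<And>k n. \<exists>B. \<forall>x. (1 + \<bar>x\<bar>) ^ n * norm (nderiv k f x) \<le> B"
begin

lemma cont [continuous_intros]: "continuous_on S (nderiv k f)"
  using smooth_nderiv_continuous[OF smooth] continuous_on_subset by blast

lemma pairing_integrand_continuous:
  "continuous_on UNIV (\<lambda>x. x ^ j *\<^sub>R (nderiv k f x * cnj (nderiv l f x)))"
  by (intro continuous_intros)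

lemma pairing_integrand_decay:
  "\<exists>B. \<forall>x. norm (x ^ j *\<^sub>R (nderiv k f x * cnj (nderiv l f x))) * (1 + x\<^sup>2) \<le> B"
proof -
  obtain B1 where B1: "\<And>x. (1 + \<bar>x\<bar>) ^ (j + 2) * norm (nderiv k f x) \<le> B1" using poly_decay by blast
  obtain B2 where B2: "\<And>x. (1 + \<bar>x\<bar>) ^ 0 * norm (nderiv l f x) \<le> B2" using poly_decay by blast
  have "norm (x ^ j *\<^sub>R (nderiv k f x * cnj (nderiv l f x))) * (1 + x\<^sup>2) \<le> B1 * B2" for x
  proof -
    have "\<bar>x\<bar> ^ j * (1 + x\<^sup>2) \<le> (1 + \<bar>x\<bar>) ^ j * (1 + \<bar>x\<bar>) ^ 2"
      by (intro mult_mono power_mono) (auto simp: power2_sum)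
    then have "(\<bar>x\<bar> ^ j * (1 + x\<^sup>2) * norm (nderiv k f x)) * norm (nderiv l f x)
        \<le> ((1 + \<bar>x\<bar>) ^ (j + 2) * norm (nderiv k f x)) * norm (nderiv l f x)"
      by (intro mult_right_mono) (simp_all only: power_add norm_ge_zero)
    also have "\<dots> \<le> B1 * B2"
      using B2[of x] order_trans[OF _ B1[of 0]] by (intro mult_mono B1) auto
    finally show ?thesis by (simp add: norm_mult power_abs mult_ac)
  qed
  then show ?thesis by blast
qed

lemma pairing_integrable: "integrable lborel (\<lambda>x. x ^ j *\<^sub>R (nderiv k f x * cnj (nderiv l f x)))"
proof -
  obtain B where "\<And>x. norm (x ^ j *\<^sub>R (nderiv k f x * cnj (nderiv l f x))) * (1 + x\<^sup>2) \<le> B"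
    using pairing_integrand_decay by blast
  then show ?thesis by (rule decay_integrable[OF pairing_integrand_continuous])
qed

lemma pairing_has_vector_derivative:
  "((\<lambda>x. x ^ j *\<^sub>R (nderiv k f x * cnj (nderiv l f x))) has_vector_derivative
     (real j *\<^sub>R (x ^ (j - 1) *\<^sub>R (nderiv k f x * cnj (nderiv l f x)))
      + x ^ j *\<^sub>R (nderiv (Suc k) f x * cnj (nderiv l f x))
      + x ^ j *\<^sub>R (nderiv k f x * cnj (nderiv (Suc l) f x)))) (at x)"
proof -
  have "((\<lambda>x. cnj (nderiv l f x)) has_vector_derivative cnj (nderiv (Suc l) f x)) (at x)"
    by (rule bounded_linear.has_vector_derivative[OF bounded_linear_cnj smooth_has_vector_derivative[OF smooth]])
  then have "((\<lambda>x. nderiv k f x * cnj (nderiv l f x)) has_vector_derivative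
      nderiv k f x * cnj (nderiv (Suc l) f x) + nderiv (Suc k) f x * cnj (nderiv l f x)) (at x)"
    by (rule has_vector_derivative_mult[OF smooth_has_vector_derivative[OF smooth]])
  moreover have "((\<lambda>x. x ^ j) has_real_derivative real j * x ^ (j - 1)) (at x)"
    by (auto intro!: derivative_eq_intros)
  ultimately have "((\<lambda>x. x ^ j *\<^sub>R (nderiv k f x * cnj (nderiv l f x))) has_vector_derivative
      x ^ j *\<^sub>R (nderiv k f x * cnj (nderiv (Suc l) f x) + nderiv (Suc k) f x * cnj (nderiv l f x))
      + (real j * x ^ (j - 1)) *\<^sub>R (nderiv k f x * cnj (nderiv l f x))) (at x)"
    by (intro has_vector_derivative_scaleR)
  then show ?thesis by (simp only: scaleR_right_distrib scaleR_scaleR add_ac)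
qed

lemma
  defines "G \<equiv> \<lambda>j k l x. x ^ j *\<^sub>R (nderiv k f x * cnj (nderiv l f x))"
  defines "G' \<equiv> \<lambda>j k l x. real j *\<^sub>R G (j - 1) k l x + G j (Suc k) l x + G j k (Suc l) x"
  shows pairing_derivative_integral: "(\<integral>x. G' j k l x \<partial>lborel) = 0"
    and pairing_sup: "norm (G j k l y) \<le> (\<integral>x. norm (G' j k l x) \<partial>lborel)"
proof -
  obtain B where B: "\<And>x. norm (G j k l x) * (1 + x\<^sup>2) \<le> B"
    using pairing_integrand_decay[of j k l] unfolding G_def by blast
  obtain B1 where B1: "\<And>x. norm (G (j - 1) k l x) * (1 + x\<^sup>2) \<le> B1"
    using pairing_integrand_decay[of "j - 1" k l] unfolding G_def by blast
  obtain B2 where B2: "\<And>x. norm (G j (Suc k) l x) * (1 + x\<^sup>2) \<le> B2"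
    using pairing_integrand_decay[of j "Suc k" l] unfolding G_def by blast
  obtain B3 where B3: "\<And>x. norm (G j k (Suc l) x) * (1 + x\<^sup>2) \<le> B3"
    using pairing_integrand_decay[of j k "Suc l"] unfolding G_def by blast
  have B': "norm (G' j k l x) * (1 + x\<^sup>2) \<le> real j * B1 + B2 + B3" for x
  proof -
    have "norm (G' j k l x) \<le> real j * norm (G (j - 1) k l x) + norm (G j (Suc k) l x) + norm (G j k (Suc l) x)"
      unfolding G'_def
      by (rule order_trans[OF norm_triangle_ineq] order_trans[OF add_right_mono[OF norm_triangle_ineq]])+ simp
    then have "norm (G' j k l x) * (1 + x\<^sup>2) \<le>
        (real j * norm (G (j - 1) k l x) + norm (G j (Suc k) l x) + norm (G j k (Suc l) x)) * (1 + x\<^sup>2)"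
      by (rule mult_right_mono) simp
    also have "\<dots> = real j * (norm (G (j - 1) k l x) * (1 + x\<^sup>2)) + norm (G j (Suc k) l x) * (1 + x\<^sup>2)
        + norm (G j k (Suc l) x) * (1 + x\<^sup>2)"
      by (simp only: distrib_right mult.assoc)
    also have "\<dots> \<le> real j * B1 + B2 + B3"
      by (intro add_mono mult_left_mono B1 B2 B3) simp
    finally show ?thesis .
  qed
  have D: "(G j k l has_vector_derivative G' j k l x) (at x)" for x
    unfolding G_def G'_def by (rule pairing_has_vector_derivative)
  have C: "continuous_on UNIV (G' j k l)"
    unfolding G_def G'_def by (intro continuous_intros)
  show "(\<integral>x. G' j k l x \<partial>lborel) = 0" by (rule integral_derivative_eq_0[OF D C B B'])
  show "norm (G j k l y) \<le> (\<integral>x. norm (G' j k l x) \<partial>lborel)"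
    by (rule norm_le_integral_derivative[OF D C B B'])
qed

lemma pairing_by_parts:
  "pairing f j k (Suc l) = - (real j *\<^sub>R pairing f (j - 1) k l) - pairing f j (Suc k) l"
proof -
  have "real j *\<^sub>R pairing f (j - 1) k l + pairing f j (Suc k) l + pairing f j k (Suc l) = 0"
    using pairing_derivative_integral[of j k l] pairing_integrable unfolding pairing_def
    by (simp only: Bochner_Integration.integral_add Bochner_Integration.integrable_add
        integral_scaleR_right integrable_scaleR_right)
  then show ?thesis by (simp add: algebra_simps eq_neg_iff_add_eq_0)
qed

lemma pairing_diag:
  "norm (pairing f (2 * j) k k) = (\<integral>x. (\<bar>x\<bar> ^ j * norm (nderiv k f x))\<^sup>2 \<partial>lborel)"
  "integrable lborel (\<lambda>x. (\<bar>x\<bar> ^ j * norm (nderiv k f x))\<^sup>2)"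
proof -
  have eq: "x ^ (2 * j) *\<^sub>R (nderiv k f x * cnj (nderiv k f x))
      = complex_of_real ((\<bar>x\<bar> ^ j * norm (nderiv k f x))\<^sup>2)" for x
  proof -
    have "x ^ (2 * j) = (\<bar>x\<bar> ^ j)\<^sup>2" by (metis power2_abs power_abs power_mult mult.commute)
    then show ?thesis
      by (simp only: complex_norm_square[symmetric] scaleR_conv_of_real power_mult_distrib of_real_mult of_real_power)
  qed
  show i: "integrable lborel (\<lambda>x. (\<bar>x\<bar> ^ j * norm (nderiv k f x))\<^sup>2)"
    using pairing_integrable[of "2 * j" k k] unfolding eq by (simp only: integrable_of_real complex_of_real_integrable_eq)
  show "norm (pairing f (2 * j) k k) = (\<integral>x. (\<bar>x\<bar> ^ j * norm (nderiv k f x))\<^sup>2 \<partial>lborel)"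
    unfolding pairing_def eq
    by (simp only: integral_complex_of_real norm_of_real) (rule abs_of_nonneg, rule Bochner_Integration.integral_nonneg, simp)
qed

text \<open>A Sobolev inequality: \<open>x ^ (2 * j) * \<bar>nderiv k f x\<bar>\<^sup>2\<close> is at most the integral of the modulus
  of its derivative.\<close>
lemma sup_le_pairing:
  "(\<bar>y\<bar> ^ j * norm (nderiv k f y))\<^sup>2 \<le> (real j)\<^sup>2 * norm (pairing f (2 * (j - 1)) k k)
    + 2 * norm (pairing f (2 * j) k k) + norm (pairing f (2 * j) (Suc k) (Suc k))"
proof -
  have norm_triangle3: "norm (a + b + c) \<le> norm a + norm b + norm c" for a b c :: complex
    using norm_triangle_ineq[of "a + b" c] norm_triangle_ineq[of a b] by linarith
  have young: "2 * (t * u) + u * v + u * v \<le> t\<^sup>2 + 2 * u\<^sup>2 + v\<^sup>2" for t u v :: real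
    using sum_squares_bound[of t u] sum_squares_bound[of u v] by (simp add: mult.assoc)
  define G where "G = (\<lambda>j k l x. x ^ j *\<^sub>R (nderiv k f x * cnj (nderiv l f x)))"
  define S where "S = (\<lambda>j k x. (\<bar>x\<bar> ^ j * norm (nderiv k f x))\<^sup>2)"
  have intG: "integrable lborel (G j k l)" for j k l
    unfolding G_def by (rule pairing_integrable)
  have intS: "integrable lborel (S j k)" for j k
    unfolding S_def by (rule pairing_diag(2))
  have "S j k y = norm (G (2 * j) k k y)"
    by (simp only: S_def G_def norm_mult norm_scaleR complex_mod_cnj power_mult_distrib power2_eq_square
        mult_2 power_add abs_mult power_abs) (simp only: mult_ac)
  also have "\<dots> \<le> (\<integral>x. norm (real (2 * j) *\<^sub>R G (2 * j - 1) k k x + G (2 * j) (Suc k) k x + G (2 * j) k (Suc k) x) \<partial>lborel)"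
    using pairing_sup[where j = "2 * j" and k = k and l = k and y = y] unfolding G_def .
  also have "\<dots> \<le> (\<integral>x. (real j)\<^sup>2 * S (j - 1) k x + 2 * S j k x + S j (Suc k) x \<partial>lborel)"
  proof (rule Bochner_Integration.integral_mono)
    show "integrable lborel (\<lambda>x. norm (real (2 * j) *\<^sub>R G (2 * j - 1) k k x + G (2 * j) (Suc k) k x + G (2 * j) k (Suc k) x))"
      by (intro integrable_norm Bochner_Integration.integrable_add integrable_scaleR_right intG)
    show "integrable lborel (\<lambda>x. (real j)\<^sup>2 * S (j - 1) k x + 2 * S j k x + S j (Suc k) x)"
      by (intro Bochner_Integration.integrable_add integrable_mult_right intS)
    fix x :: real
    \<comment> \<open>The product rule yields one term of size \<open>2 * (?t * ?u)\<close> and two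
      of size \<open>?u * ?v\<close>. Splitting the products into squares leaves only diagonal
      pairings, that is, integrals of squares.\<close>
    let ?u = "\<bar>x\<bar> ^ j * norm (nderiv k f x)"
    let ?v = "\<bar>x\<bar> ^ j * norm (nderiv (Suc k) f x)"
    let ?t = "real j * (\<bar>x\<bar> ^ (j - 1) * norm (nderiv k f x))"
    have t: "norm (real (2 * j) *\<^sub>R G (2 * j - 1) k k x) = 2 * (?t * ?u)"
    proof (cases j)
      case (Suc i)
      have "2 * j - 1 = (j - 1) + j" using Suc by simp
      then have "\<bar>x\<bar> ^ (2 * j - 1) = \<bar>x\<bar> ^ (j - 1) * \<bar>x\<bar> ^ j" by (simp only: power_add)
      moreover have "norm (real (2 * j) *\<^sub>R G (2 * j - 1) k k x)
          = 2 * (real j * (\<bar>x\<bar> ^ (2 * j - 1) * (norm (nderiv k f x) * norm (nderiv k f x))))"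
        by (simp only: G_def norm_scaleR norm_mult complex_mod_cnj power_abs abs_of_nat of_nat_mult
            of_nat_numeral abs_mult abs_numeral mult.assoc)
      ultimately show ?thesis by (simp only: mult_ac)
    qed simp
    have v: "norm (G (2 * j) (Suc k) k x) = ?u * ?v" "norm (G (2 * j) k (Suc k) x) = ?u * ?v"
      by (simp_all only: G_def norm_mult norm_scaleR complex_mod_cnj mult_2 power_add power_abs abs_mult)
        (simp_all only: mult_ac)
    have "norm (real (2 * j) *\<^sub>R G (2 * j - 1) k k x + G (2 * j) (Suc k) k x + G (2 * j) k (Suc k) x)
        \<le> 2 * (?t * ?u) + ?u * ?v + ?u * ?v"
      using norm_triangle3[of "real (2 * j) *\<^sub>R G (2 * j - 1) k k x" "G (2 * j) (Suc k) k x" "G (2 * j) k (Suc k) x"]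
      by (simp only: t v)
    also have "\<dots> \<le> ?t\<^sup>2 + 2 * ?u\<^sup>2 + ?v\<^sup>2"
      by (rule young)
    also have "\<dots> = (real j)\<^sup>2 * S (j - 1) k x + 2 * S j k x + S j (Suc k) x"
      by (simp only: S_def power_mult_distrib)
    finally show "norm (real (2 * j) *\<^sub>R G (2 * j - 1) k k x + G (2 * j) (Suc k) k x + G (2 * j) k (Suc k) x)
        \<le> (real j)\<^sup>2 * S (j - 1) k x + 2 * S j k x + S j (Suc k) x" .
  qed
  also have "\<dots> = (real j)\<^sup>2 * norm (pairing f (2 * (j - 1)) k k)
    + 2 * norm (pairing f (2 * j) k k) + norm (pairing f (2 * j) (Suc k) (Suc k))"
    unfolding pairing_diag using intS
    by (simp only: Bochner_Integration.integral_add Bochner_Integration.integrable_add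
        integral_mult_right_zero integrable_mult_right) (simp only: S_def)
  finally show ?thesis unfolding S_def .
qed

end

section \<open>Moment bounds for the pairings and for joint suprema\<close>

context subadditive_rapid
begin

text \<open>A partial integration produces a term with \<open>j\<close> lowered and a term with
  \<open>k\<close> raised. Both are controlled by \<open>m\<close> with constant one, so each order
  costs only a factor 2; working with the moments directly would produce powers of
  \<open>1 / moment v 1\<close>.\<close>

lemma pairing_le_moment:
  assumes v: "v > 0" and f: "schwartz_function f"
    and C0: "C0 \<ge> 0" "\<And>k x. norm (nderiv k f x) \<le> C0 * moment v k"
    and B: "\<And>x. norm (f x) * exp ((v + 1) * w \<bar>x\<bar>) \<le> B"
  obtains C where "C \<ge> 0"
    "\<And>j k l. norm (pairing f j k l) \<le> C * 2 ^ (j + k + 2 * l) * (moment v j * moment v (k + l))"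
proof -
  interpret f: schwartz_function f by (rule f)
  obtain D where D0: "D > 0" and D': "\<And>x B n. norm (f x) * exp ((v + 1) * w \<bar>x\<bar>) \<le> B \<Longrightarrow>
      norm (x ^ n *\<^sub>R f x) * (1 + x\<^sup>2) \<le> B * D * moment v n"
    by (rule weight_decay[OF v, of f]) (rule that)
  note D = D0 D'[OF B]
  have B0: "0 \<le> B" by (rule order_trans[OF _ B[of 0]]) simp
  define C where "C = C0 * B * D * pi"
  obtain m K where K: "K > 0" and m: "\<And>n. moment v n \<le> m n" "\<And>n. m n \<le> K * 2 ^ n * moment v n"
    "\<And>n. real n * m (n - 1) \<le> m n" "\<And>n. m n \<le> m (Suc n)"
    by (rule moment_majorant[OF v]) (rule that)
  have M: "0 < moment v k" for k using moment_pos[OF v] .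
  have m0: "0 \<le> m k" for k using less_imp_le[OF M] m(1) by (rule order_trans)
  have C: "C \<ge> 0" using B0 D C0 by (simp add: C_def)
  have ind: "norm (pairing f j k l) \<le> C * 2 ^ l * (m j * m (k + l))" for j k l
  proof (induction l arbitrary: j k)
    case 0
    \<comment> \<open>For \<open>l = 0\<close> the two kinds of information separate: the regularity
      of \<open>f\<close> gives the moment in \<open>k\<close>, its decay the one in
      \<open>j\<close>.\<close>
    have "norm (x ^ j *\<^sub>R (nderiv k f x * cnj (nderiv 0 f x))) * (1 + x\<^sup>2)
        \<le> C0 * B * D * (m j * m k)" for x
    proof -
      have "norm (x ^ j *\<^sub>R (nderiv k f x * cnj (nderiv 0 f x))) * (1 + x\<^sup>2)
          = norm (nderiv k f x) * (norm (x ^ j *\<^sub>R f x) * (1 + x\<^sup>2))"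
        by (simp add: norm_mult)
      also have "\<dots> \<le> (C0 * moment v k) * (B * D * moment v j)"
        using C0 M[of k] by (intro mult_mono C0 D) auto
      also have "\<dots> \<le> (C0 * m k) * (B * D * m j)"
        using C0 B0 D0 m0 M less_imp_le[OF M] by (intro mult_mono mult_left_mono m) auto
      finally show ?thesis by (simp only: mult_ac)
    qed
    from decay_integral_norm[OF f.pairing_integrand_continuous this]
    have "norm (pairing f j k 0) \<le> C0 * B * D * (m j * m k) * pi"
      unfolding pairing_def by (rule order_trans[OF integral_norm_bound])
    then show ?case by (simp add: C_def mult_ac)
  next
    case (Suc l)
    have 1: "real j * norm (pairing f (j - 1) k l) \<le> C * 2 ^ l * (m j * m (k + Suc l))"
    proof -
      have "real j * norm (pairing f (j - 1) k l) \<le> real j * (C * 2 ^ l * (m (j - 1) * m (k + l)))"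
        by (intro mult_left_mono Suc.IH) simp
      also have "\<dots> = C * 2 ^ l * ((real j * m (j - 1)) * m (k + l))" by simp
      also have "\<dots> \<le> C * 2 ^ l * (m j * m (Suc (k + l)))"
        using C m0 by (intro mult_left_mono mult_mono m) auto
      finally show ?thesis by simp
    qed
    have 2: "norm (pairing f j (Suc k) l) \<le> C * 2 ^ l * (m j * m (k + Suc l))"
      using Suc.IH[of j "Suc k"] by simp
    have "norm (pairing f j k (Suc l)) \<le> real j * norm (pairing f (j - 1) k l) + norm (pairing f j (Suc k) l)"
      unfolding f.pairing_by_parts
      by (rule order_trans[OF norm_triangle_ineq4]) simp
    also have "\<dots> \<le> C * 2 ^ l * (m j * m (k + Suc l)) + C * 2 ^ l * (m j * m (k + Suc l))"
      by (intro add_mono 1 2)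
    finally show ?case by (simp add: mult_ac)
  qed
  have "norm (pairing f j k l) \<le> (C * K\<^sup>2) * 2 ^ (j + k + 2 * l) * (moment v j * moment v (k + l))" for j k l
  proof -
    \<comment> \<open>Returning from \<open>m\<close> to the moments costs \<open>2 ^ j\<close> and
      \<open>2 ^ (k + l)\<close>; with \<open>2 ^ l\<close> from the induction this is the exponent
      \<open>j + k + 2 * l\<close>.\<close>
    have "m j * m (k + l) \<le> (K * 2 ^ j * moment v j) * (K * 2 ^ (k + l) * moment v (k + l))"
      using m0 K M by (intro mult_mono m) (auto intro: less_imp_le)
    then have "C * 2 ^ l * (m j * m (k + l))
        \<le> C * 2 ^ l * ((K * 2 ^ j * moment v j) * (K * 2 ^ (k + l) * moment v (k + l)))"
      using C by (intro mult_left_mono) auto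
    with ind[of j k l] have "norm (pairing f j k l)
        \<le> C * 2 ^ l * ((K * 2 ^ j * moment v j) * (K * 2 ^ (k + l) * moment v (k + l)))"
      by (rule order_trans)
    also have "\<dots> = (C * K\<^sup>2) * 2 ^ (j + k + 2 * l) * (moment v j * moment v (k + l))"
    proof -
      have "(2::real) ^ (j + k + 2 * l) = 2 ^ l * 2 ^ j * 2 ^ (k + l)"
        by (simp flip: power_add add: algebra_simps)
      then show ?thesis by (simp add: power2_eq_square)
    qed
    finally show ?thesis .
  qed
  moreover have "0 \<le> C * K\<^sup>2" using C by simp
  ultimately show thesis using that by blast
qed

text \<open>Diagonal pairings of order \<open>2 * j\<close> are squared weighted norms, and the
  Sobolev inequality turns them into suprema at the price of one derivative, hence
  \<open>Suc k\<close>. The parameter \<open>2 * u\<close> becomes \<open>u\<close> through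
  \<open>moment_double\<close>.\<close>

lemma mixed_sup_estimate:
  assumes u: "u > 0" and f: "schwartz_function f"
    and C0: "C0 \<ge> 0" "\<And>k x. norm (nderiv k f x) \<le> C0 * moment (2 * u) k"
    and B: "\<And>x. norm (f x) * exp ((2 * u + 1) * w \<bar>x\<bar>) \<le> B"
  obtains C where "C \<ge> 0"
    "\<And>j k x. \<bar>x\<bar> ^ j * norm (nderiv k f x) \<le> C * 8 ^ k * (2 ^ j * moment u j * moment u (Suc k))"
proof -
  interpret f: schwartz_function f by (rule f)
  have u2: "2 * u > 0" using u by simp
  obtain C where C: "C \<ge> 0" and I: "\<And>j k l. norm (pairing f j k l)
      \<le> C * 2 ^ (j + k + 2 * l) * (moment (2 * u) j * moment (2 * u) (k + l))"
    by (rule pairing_le_moment[OF u2 f C0 B]) (rule that)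
  have M: "0 < moment u k" for k using moment_pos[OF u] .
  define N where "N = (\<lambda>j. 2 ^ j * moment u j)"
  have N: "0 < N j" for j using M by (simp add: N_def)
  \<comment> \<open>This is \<open>2 ^ 3\<close>: for \<open>2 * j\<close> and \<open>l = k\<close>
    the exponent of 2 in the pairing bound is \<open>2 * j + 3 * k\<close>.\<close>
  define A :: real where "A = 8"
  have A: "A \<ge> 1" by (simp add: A_def)
  have J: "norm (pairing f (2 * j) k k) \<le> C * A ^ k * (N j * moment u k)\<^sup>2" for j k
  proof -
    have "moment (2 * u) (2 * j) * moment (2 * u) (2 * k) \<le> (moment u j)\<^sup>2 * (moment u k)\<^sup>2"
      using moment_pos[of "2 * u" "2 * k"] u by (intro mult_mono moment_double) auto
    then have "C * 2 ^ (2 * j + k + 2 * k) * (moment (2 * u) (2 * j) * moment (2 * u) (2 * k))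
        \<le> C * 2 ^ (2 * j + k + 2 * k) * ((moment u j)\<^sup>2 * (moment u k)\<^sup>2)"
      using C by (intro mult_left_mono) auto
    also have "(2::real) ^ (2 * j + k + 2 * k) = (2 ^ j)\<^sup>2 * A ^ k"
    proof -
      have "(2::real) ^ (2 * j + k + 2 * k) = 2 ^ (j * 2) * 2 ^ (3 * k)"
        by (simp flip: power_add add: algebra_simps)
      then show ?thesis by (simp only: power_mult A_def) simp
    qed
    finally have "C * ((2 ^ j)\<^sup>2 * A ^ k) * (moment (2 * u) (2 * j) * moment (2 * u) (2 * k))
        \<le> C * A ^ k * (N j * moment u k)\<^sup>2"
      by (simp only: N_def power_mult_distrib mult_ac)
    moreover have "norm (pairing f (2 * j) k k)
        \<le> C * ((2 ^ j)\<^sup>2 * A ^ k) * (moment (2 * u) (2 * j) * moment (2 * u) (2 * k))"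
      using I[of "2 * j" k k, folded mult_2] \<open>2 ^ (2 * j + k + 2 * k) = (2 ^ j)\<^sup>2 * A ^ k\<close> by (simp only:)
    ultimately show ?thesis by (rule order_trans[rotated])
  qed
  \<comment> \<open>\<open>r\<close> depends on \<open>u\<close>, but occurs only in powers of fixed
    order and therefore only in the constant \<open>E\<close>.\<close>
  define r where "r = 1 / moment u 1"
  have r: "r \<ge> 0" using M[of 1] by (simp add: r_def)
  have step: "moment u k \<le> r * moment u (Suc k)" for k
    using moment_le_Suc[OF u, of k] by (simp add: r_def)
  define E where "E = C * (r ^ 4 + 2 * r\<^sup>2 + A)"
  have E: "E \<ge> 0" using C r A by (simp add: E_def)
  have "\<bar>x\<bar> ^ j * norm (nderiv k f x) \<le> (1 + E) * A ^ k * (N j * moment u (Suc k))" for j k x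
  proof -
    let ?P = "(N j * moment u (Suc k))\<^sup>2"
    have 1: "(real j)\<^sup>2 * norm (pairing f (2 * (j - 1)) k k) \<le> C * A ^ k * r ^ 4 * ?P"
    proof -
      have jN: "real j * N (j - 1) \<le> r * N j"
      proof (cases j)
        case (Suc i)
        have "real j * N (j - 1) = 2 ^ i * (real (Suc i) * moment u i)" using Suc by (simp add: N_def)
        also have "\<dots> \<le> 2 ^ j * (moment u (Suc i) / moment u 1)"
          using Suc M[of i] by (intro mult_mono moment_Suc u) auto
        finally show ?thesis using Suc by (simp add: N_def r_def)
      qed (use N r in \<open>simp add: less_imp_le\<close>)
      have "real j * N (j - 1) * moment u k \<le> (r * N j) * (r * moment u (Suc k))"
        using M[of k] N[of j] r by (intro mult_mono[OF jN step]) auto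
      then have "(real j * N (j - 1) * moment u k)\<^sup>2 \<le> ((r * N j) * (r * moment u (Suc k)))\<^sup>2"
        using M[of k] N[of "j - 1"] by (intro power_mono) auto
      then have "C * A ^ k * (real j * N (j - 1) * moment u k)\<^sup>2
          \<le> C * A ^ k * ((r * N j) * (r * moment u (Suc k)))\<^sup>2"
        using C A by (intro mult_left_mono) auto
      moreover have "(real j)\<^sup>2 * norm (pairing f (2 * (j - 1)) k k)
          \<le> (real j)\<^sup>2 * (C * A ^ k * (N (j - 1) * moment u k)\<^sup>2)"
        by (intro mult_left_mono J) simp
      moreover have "(real j)\<^sup>2 * (C * A ^ k * (N (j - 1) * moment u k)\<^sup>2)
          = C * A ^ k * (real j * N (j - 1) * moment u k)\<^sup>2"
        by (simp only: power_mult_distrib mult_ac)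
      moreover have "C * A ^ k * ((r * N j) * (r * moment u (Suc k)))\<^sup>2
          = C * A ^ k * r ^ 4 * (N j * moment u (Suc k))\<^sup>2"
      proof -
        have "r ^ 4 = r\<^sup>2 * r\<^sup>2" by (simp flip: power_add)
        then show ?thesis by (simp only: power_mult_distrib mult_ac)
      qed
      ultimately show ?thesis by linarith
    qed
    have 2: "2 * norm (pairing f (2 * j) k k) \<le> C * A ^ k * (2 * r\<^sup>2) * ?P"
    proof -
      have "(N j * moment u k)\<^sup>2 \<le> (N j * (r * moment u (Suc k)))\<^sup>2"
        using N[of j] M[of k] by (intro power_mono mult_left_mono step) auto
      then have "C * A ^ k * (N j * moment u k)\<^sup>2 \<le> C * A ^ k * (N j * (r * moment u (Suc k)))\<^sup>2"
        using C A by (intro mult_left_mono) auto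
      then show ?thesis using J[of j k] by (simp add: power_mult_distrib mult_ac)
    qed
    have 3: "norm (pairing f (2 * j) (Suc k) (Suc k)) \<le> C * A ^ k * A * ?P"
      using J[of j "Suc k"] by (simp add: mult_ac)
    have "(\<bar>x\<bar> ^ j * norm (nderiv k f x))\<^sup>2
        \<le> C * A ^ k * r ^ 4 * ?P + C * A ^ k * (2 * r\<^sup>2) * ?P + C * A ^ k * A * ?P"
      by (rule order_trans[OF f.sup_le_pairing]) (intro add_mono 1 2 3)
    also have "\<dots> = E * A ^ k * ?P"
      by (simp only: E_def distrib_left distrib_right mult_ac)
    \<comment> \<open>Enlarging the constants gives a perfect square. The loss of half the exponent
      of \<open>A\<close> is harmless, since \<open>moment_scale\<close> absorbs any fixed geometric
      factor.\<close>
    also have "\<dots> \<le> (1 + E)\<^sup>2 * (A ^ k)\<^sup>2 * ?P"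
    proof (intro mult_right_mono mult_mono)
      show "E \<le> (1 + E)\<^sup>2" using E by (simp add: power2_sum)
      show "A ^ k \<le> (A ^ k)\<^sup>2" using A by (simp add: power2_eq_square)
    qed (use A in auto)
    also have "\<dots> = ((1 + E) * A ^ k * (N j * moment u (Suc k)))\<^sup>2"
      by (simp only: power_mult_distrib)
    finally show ?thesis
      by (rule power2_le_imp_le) (use E A N[of j] M[of "Suc k"] in simp)
  qed
  then show thesis using that[of "1 + E"] E unfolding N_def A_def by simp
qed

end

section \<open>From the seminorms to joint control of derivatives and decay\<close>

lemma gs_seminorm_finite_iff:
  "gs_seminorm \<omega> l j f < \<infinity> \<longleftrightarrow>
    (\<exists>B. (\<forall>x. norm (nderiv j f x) * exp (l * \<omega> \<bar>x\<bar>) \<le> B) \<and>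
         (\<forall>\<xi>. norm (nderiv j (fourier f) \<xi>) * exp (l * \<omega> \<bar>\<xi>\<bar>) \<le> B))"
proof -
  have SUP: "(SUP x. ennreal (g x)) < \<infinity> \<longleftrightarrow> (\<exists>B. \<forall>x. g x \<le> B)" if "\<And>x. 0 \<le> g x" for g :: "real \<Rightarrow> real"
  proof
    assume "(SUP x. ennreal (g x)) < \<infinity>"
    then obtain B where B: "B \<ge> 0" "(SUP x. ennreal (g x)) = ennreal B"
      by (cases "SUP x. ennreal (g x)") auto
    have "g x \<le> B" for x
      using SUP_upper[of x UNIV "\<lambda>x. ennreal (g x)"] B by (simp add: ennreal_le_iff)
    then show "\<exists>B. \<forall>x. g x \<le> B" by blast
  next
    assume "\<exists>B. \<forall>x. g x \<le> B"
    then obtain B where "\<And>x. g x \<le> B" by blast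
    then have "(SUP x. ennreal (g x)) \<le> ennreal B" by (intro SUP_least ennreal_leI)
    then show "(SUP x. ennreal (g x)) < \<infinity>" by (rule order_le_less_trans) simp
  qed
  have "(\<exists>B. \<forall>x. g x \<le> B) \<and> (\<exists>B. \<forall>x. h x \<le> B) \<longleftrightarrow> (\<exists>B. (\<forall>x. g x \<le> B) \<and> (\<forall>x. h x \<le> B))"
    for g h :: "real \<Rightarrow> real"
    by (meson le_max_iff_disj max.cobounded1 order_trans max.cobounded2)
  then show ?thesis unfolding gs_seminorm_def max_less_iff_conj by (subst (1 2) SUP) auto
qed

context subadditive_rapid
begin

text \<open>Here the seminorms of positive order enter, without control of their growth: they
  justify the partial integrations.\<close>

lemma gelfand_shilov_schwartz:
  assumes "smooth f"
    and "\<And>l k. l > 0 \<Longrightarrow> \<exists>B. \<forall>x. norm (nderiv k f x) * exp (l * w \<bar>x\<bar>) \<le> B"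
  shows "schwartz_function f"
proof
  fix k n
  obtain B where B: "\<And>x. norm (nderiv k f x) * exp (1 * w \<bar>x\<bar>) \<le> B" using assms(2)[of 1 k] by auto
  obtain D where D: "\<And>t. t \<ge> 0 \<Longrightarrow> (1 + t) ^ n * exp (- (1 * w t)) \<le> D"
    using rapid_shifted[of 1 n] by auto
  have "(1 + \<bar>x\<bar>) ^ n * norm (nderiv k f x) \<le> D * B" for x
  proof -
    have "(1 + \<bar>x\<bar>) ^ n * norm (nderiv k f x)
        = ((1 + \<bar>x\<bar>) ^ n * exp (- (1 * w \<bar>x\<bar>))) * (norm (nderiv k f x) * exp (1 * w \<bar>x\<bar>))"
      by (simp add: exp_minus field_simps)
    also have "\<dots> \<le> D * B"
      using order_trans[OF _ D[of 0]] by (intro mult_mono D B) auto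
    finally show ?thesis .
  qed
  then show "\<exists>B. \<forall>x. (1 + \<bar>x\<bar>) ^ n * norm (nderiv k f x) \<le> B" by blast
qed (rule assms(1))

lemma gelfand_shilov_mixed_estimate:
  assumes f: "f \<in> gelfand_shilov w" and u: "u > 0"
  obtains C where "C \<ge> 0"
    "\<And>k x. norm (nderiv k f x) \<le> C * moment u k * exp (- (u * w \<bar>x\<bar>))"
proof -
  have sm: "smooth f" "smooth (fourier f)" and int: "integrable lborel f"
    using f by (auto simp: gelfand_shilov_def)
  have bd: "\<exists>B. (\<forall>x. norm (nderiv j f x) * exp (l * w \<bar>x\<bar>) \<le> B) \<and>
         (\<forall>\<xi>. norm (nderiv j (fourier f) \<xi>) * exp (l * w \<bar>\<xi>\<bar>) \<le> B)" if "l > 0" for l j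
    using f that unfolding gelfand_shilov_def gs_seminorm_finite_iff by blast
  have sf: "schwartz_function f" using bd by (intro gelfand_shilov_schwartz sm) blast
  interpret f: schwartz_function f by (rule sf)
  \<comment> \<open>The parameter \<open>16 * u\<close> is halved once to remove the shift in
    \<open>Suc k\<close>; the remaining \<open>8 * u\<close> drops to \<open>u\<close> in exchange
    for \<open>8 ^ k\<close>.\<close>
  have pos: "8 * u > 0" "16 * u > 0" "2 * (16 * u) > 0" "2 * (16 * u) + 1 > 0" using u by auto
  obtain B where B: "\<And>x. norm (f x) * exp ((2 * (16 * u) + 1) * w \<bar>x\<bar>) \<le> B"
      "\<And>\<xi>. norm (fourier f \<xi>) * exp ((2 * (16 * u) + 1) * w \<bar>\<xi>\<bar>) \<le> B"
    using bd[OF pos(4), of 0] by auto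
  obtain B0 where B0: "\<And>x. norm (f x) \<le> B0" using f.poly_decay[of 0 0] by auto
  obtain C0 where C0: "C0 \<ge> 0" "\<And>k x. norm (nderiv k f x) \<le> C0 * moment (2 * (16 * u)) k"
    by (rule nderiv_le_moment[OF pos(3) int f.cont[of UNIV 0, simplified] B0
        smooth_nderiv_continuous[OF sm(2), of 0, simplified] B(2)]) (rule that)
  obtain C where C: "C \<ge> 0" and mix: "\<And>j k x. \<bar>x\<bar> ^ j * norm (nderiv k f x)
      \<le> C * 8 ^ k * (2 ^ j * moment (16 * u) j * moment (16 * u) (Suc k))"
    by (rule mixed_sup_estimate[OF pos(2) sf C0 B(1)]) (rule that)
  obtain D where D: "D > 0" "\<And>t. t \<ge> 0 \<Longrightarrow> (1 + t) ^ 1 * exp (- (u * w t)) \<le> D"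
    using rapid_shifted[OF u, of 1] by blast
  have M8: "0 < moment (8 * u) k" for k using moment_pos[OF pos(1)] .
  define C' where "C' = C * moment (8 * u) 1 * exp (16 * u * w 1) * D"
  have "norm (nderiv k f x) \<le> C' * moment u k * exp (- (u * w \<bar>x\<bar>))" for k x
  proof -
    define b where "b = C * (moment (8 * u) 1 * moment u k)"
    have b: "b \<ge> 0" using C M8[of 1] moment_pos[OF u, of k] by (simp add: b_def)
    \<comment> \<open>Halving the argument hides the factor \<open>2 ^ j\<close> of the mixed
      estimate; subadditivity leads back from \<open>\<bar>x\<bar> / 2\<close> to
      \<open>\<bar>x\<bar>\<close> afterwards.\<close>
    have "norm (nderiv k f x) * (\<bar>x\<bar> / 2) ^ j \<le> b * moment (16 * u) j" for j
    proof -
      have "8 ^ k * moment (16 * u) (Suc k) \<le> 8 ^ k * (moment (8 * u) 1 * moment (8 * u) k)"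
        using moment_shift[OF pos(1) pos(1), of k] by simp
      also have "\<dots> = moment (8 * u) 1 * (8 ^ k * moment (8 * u) k)" by simp
      also have "\<dots> \<le> moment (8 * u) 1 * moment u k"
        using moment_scale[OF u, of 8 k] M8[of 1] by (intro mult_left_mono) auto
      finally have "C * (2 ^ j * moment (16 * u) j) * (8 ^ k * moment (16 * u) (Suc k))
          \<le> C * (2 ^ j * moment (16 * u) j) * (moment (8 * u) 1 * moment u k)"
        using C moment_pos[OF pos(2), of j] by (intro mult_left_mono) auto
      moreover have "C * 8 ^ k * (2 ^ j * moment (16 * u) j * moment (16 * u) (Suc k))
          = C * (2 ^ j * moment (16 * u) j) * (8 ^ k * moment (16 * u) (Suc k))" by (simp only: mult_ac)
      ultimately have "\<bar>x\<bar> ^ j * norm (nderiv k f x)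
          \<le> C * (2 ^ j * moment (16 * u) j) * (moment (8 * u) 1 * moment u k)"
        using mix[of x j k] by (simp only:)
      also have "\<dots> = 2 ^ j * (b * moment (16 * u) j)" by (simp add: b_def)
      finally show ?thesis by (simp add: power_divide field_simps)
    qed
    from decay_from_moments[OF pos(2) _ b this]
    have "norm (nderiv k f x) \<le> b * exp (16 * u * w 1) * (1 + \<bar>x\<bar> / 2) * exp (- (16 * u * w (\<bar>x\<bar> / 2)))" by simp
    \<comment> \<open>Of the two exponentials, one will absorb the linear factor left by
      \<open>decay_from_moments\<close>, the other is the decay claimed.\<close>
    also have "\<dots> \<le> b * exp (16 * u * w 1) * ((1 + \<bar>x\<bar>) ^ 1 * exp (- (u * w \<bar>x\<bar>)) * exp (- (u * w \<bar>x\<bar>)))"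
    proof -
      have "w \<bar>x\<bar> \<le> 2 * w (\<bar>x\<bar> / 2)" using subadd_nat[of "\<bar>x\<bar> / 2" 2] by simp
      then have "2 * u * w \<bar>x\<bar> \<le> 2 * u * (2 * w (\<bar>x\<bar> / 2))" using u by (intro mult_left_mono) auto
      also have "\<dots> \<le> 16 * u * w (\<bar>x\<bar> / 2)" using u nonneg[of "\<bar>x\<bar> / 2"] by simp
      finally have "exp (- (16 * u * w (\<bar>x\<bar> / 2))) \<le> exp (- (u * w \<bar>x\<bar>)) * exp (- (u * w \<bar>x\<bar>))"
        by (simp flip: exp_add)
      then have "(1 + \<bar>x\<bar> / 2) * exp (- (16 * u * w (\<bar>x\<bar> / 2)))
          \<le> (1 + \<bar>x\<bar>) ^ 1 * (exp (- (u * w \<bar>x\<bar>)) * exp (- (u * w \<bar>x\<bar>)))"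
        by (intro mult_mono) auto
      then have "b * exp (16 * u * w 1) * ((1 + \<bar>x\<bar> / 2) * exp (- (16 * u * w (\<bar>x\<bar> / 2))))
          \<le> b * exp (16 * u * w 1) * ((1 + \<bar>x\<bar>) ^ 1 * (exp (- (u * w \<bar>x\<bar>)) * exp (- (u * w \<bar>x\<bar>))))"
        using b by (intro mult_left_mono) auto
      then show ?thesis by (simp only: mult.assoc)
    qed
    also have "\<dots> \<le> b * exp (16 * u * w 1) * (D * exp (- (u * w \<bar>x\<bar>)))"
      using b by (intro mult_left_mono mult_right_mono D) auto
    finally show ?thesis by (simp only: C'_def b_def mult_ac)
  qed
  moreover have "C' \<ge> 0" using C M8[of 1] D(1) by (simp add: C'_def)
  ultimately show thesis using that by blast
qed

end

section \<open>Ultradifferentiable functions with decay\<close>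

context subadditive_rapid
begin

text \<open>These are the conditions given by the seminorms \<pi> with moments in place of
  exponentials of the Young conjugate. A single parameter suffices, as both factors decrease when
  \<open>l\<close> grows.\<close>

definition ultradifferentiable :: "(real \<Rightarrow> complex) \<Rightarrow> bool" where
  "ultradifferentiable g \<longleftrightarrow> smooth g \<and>
     (\<forall>l>0. \<exists>C\<ge>0. \<forall>n x. norm (nderiv n g x) \<le> C * moment l n * exp (- (l * w \<bar>x\<bar>)))"

lemma ultradifferentiableE:
  assumes "ultradifferentiable g" "l > 0"
  obtains C where "C \<ge> 0" "\<And>n x. norm (nderiv n g x) \<le> C * moment l n * exp (- (l * w \<bar>x\<bar>))"
  using assms unfolding ultradifferentiable_def by blast

lemma ultradifferentiable_exp_decay:
  assumes "ultradifferentiable g" "l > 0"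
  shows "\<exists>B. \<forall>x. norm (nderiv n g x) * exp (l * w \<bar>x\<bar>) \<le> B"
proof -
  obtain C where C: "\<And>n x. norm (nderiv n g x) \<le> C * moment l n * exp (- (l * w \<bar>x\<bar>))"
    by (rule ultradifferentiableE[OF assms]) (rule that)
  have "norm (nderiv n g x) * exp (l * w \<bar>x\<bar>) \<le> C * moment l n" for x
    using mult_right_mono[OF C[of n x], of "exp (l * w \<bar>x\<bar>)"]
    by (simp add: mult.assoc flip: exp_add)
  then show ?thesis by blast
qed

text \<open>Prepares for derivatives of the Fourier transform, which correspond to powers of
  \<open>x\<close>. Starting from the parameter \<open>l + l\<close>, one half of the decay absorbs
  \<open>\<bar>x\<bar>\<close>; the term with coefficient \<open>n\<close> is absorbed by
  \<open>moment_Suc\<close>.\<close>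

lemma ultradifferentiable_times_id:
  assumes g: "ultradifferentiable g"
  shows "ultradifferentiable (\<lambda>x. x *\<^sub>R g x)"
proof -
  have sm: "smooth g" using g by (simp add: ultradifferentiable_def)
  have "\<exists>C\<ge>0. \<forall>n x. norm (nderiv n (\<lambda>x. x *\<^sub>R g x) x) \<le> C * moment l n * exp (- (l * w \<bar>x\<bar>))"
    if l: "l > 0" for l
  proof -
    have l2: "l + l > 0" using l by simp
    obtain C where C: "C \<ge> 0" "\<And>n x. norm (nderiv n g x) \<le> C * moment (l + l) n * exp (- ((l + l) * w \<bar>x\<bar>))"
      by (rule ultradifferentiableE[OF g l2]) (rule that)
    have M: "0 < moment l n" for n using moment_pos[OF l] .
    have g': "norm (nderiv n g x) \<le> C * moment l n * (exp (- (l * w \<bar>x\<bar>)) * exp (- (l * w \<bar>x\<bar>)))" for n x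
    proof -
      have "C * moment (l + l) n * exp (- ((l + l) * w \<bar>x\<bar>)) \<le> C * moment l n * exp (- ((l + l) * w \<bar>x\<bar>))"
        using C(1) l by (intro mult_right_mono mult_left_mono moment_anti) auto
      moreover have "exp (- ((l + l) * w \<bar>x\<bar>)) = exp (- (l * w \<bar>x\<bar>)) * exp (- (l * w \<bar>x\<bar>))"
        by (simp flip: exp_add)
      ultimately show ?thesis using C(2)[of n x] by simp
    qed
    have "norm (nderiv n (\<lambda>x. x *\<^sub>R g x) x)
        \<le> (C * moment l 1 + C / moment l 1) * moment l n * exp (- (l * w \<bar>x\<bar>))" for n x
    proof -
      define e where "e = exp (- (l * w \<bar>x\<bar>))"
      have e: "0 < e" "e \<le> 1" using l nonneg[of "\<bar>x\<bar>"] by (auto simp: e_def)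
      have g'': "norm (nderiv i g x) \<le> C * moment l i * (e * e)" for i
        using g' by (simp only: e_def)
      have "\<bar>x\<bar> * norm (nderiv n g x) \<le> \<bar>x\<bar> * (C * moment l n * (e * e))"
        by (intro mult_left_mono g'') simp
      also have "\<dots> = C * (\<bar>x\<bar> ^ 1 * e) * moment l n * e" by simp
      also have "\<dots> \<le> C * moment l 1 * moment l n * e"
        unfolding e_def using C(1) M[of n] l
        by (intro mult_right_mono mult_left_mono moment_upper) auto
      finally have 1: "\<bar>x\<bar> * norm (nderiv n g x) \<le> C * moment l 1 * moment l n * e" .
      have 2: "real n * norm (nderiv (n - 1) g x) \<le> C / moment l 1 * moment l n * e"
      proof (cases n)
        case (Suc i)
        have "real n * norm (nderiv i g x) \<le> real n * (C * moment l i * (e * e))"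
          by (intro mult_left_mono g'') simp
        also have "\<dots> = C * (real (Suc i) * moment l i) * e * e" using Suc by simp
        also have "\<dots> \<le> C * (moment l (Suc i) / moment l 1) * e * 1"
          using C(1) e M[of i] M[of 1] M[of "Suc i"] by (intro mult_mono moment_Suc l) auto
        finally show ?thesis using Suc by simp
      qed (use C(1) M e in \<open>simp add: less_imp_le\<close>)
      have "norm (nderiv n (\<lambda>x. x *\<^sub>R g x) x) \<le> \<bar>x\<bar> * norm (nderiv n g x) + real n * norm (nderiv (n - 1) g x)"
        unfolding smooth_times_id(2)[OF sm] by (rule order_trans[OF norm_triangle_ineq]) simp
      with 1 2 show ?thesis unfolding e_def[symmetric] by (simp only: distrib_right)
    qed
    moreover have "0 \<le> C * moment l 1 + C / moment l 1" using C(1) M[of 1] by simp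
    ultimately show ?thesis by blast
  qed
  then show ?thesis using smooth_times_id(1)[OF sm] by (simp add: ultradifferentiable_def)
qed

lemma ultradifferentiable_times_power:
  "ultradifferentiable g \<Longrightarrow> ultradifferentiable (\<lambda>x. x ^ k *\<^sub>R g x)"
proof (induction k)
  case (Suc k)
  then show ?case using ultradifferentiable_times_id[of "\<lambda>x. x ^ k *\<^sub>R g x"] by simp
qed simp

lemma ultradifferentiable_decay:
  assumes g: "ultradifferentiable g" and l: "l > 0"
  obtains C where "C \<ge> 0" "\<And>n x. norm (nderiv n g x) * (1 + x\<^sup>2) \<le> C * moment l n"
proof -
  obtain C where C: "C \<ge> 0" "\<And>n x. norm (nderiv n g x) \<le> C * moment l n * exp (- (l * w \<bar>x\<bar>))"
    by (rule ultradifferentiableE[OF g l]) (rule that)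
  obtain D where D: "D > 0" "\<And>t. t \<ge> 0 \<Longrightarrow> (1 + t) ^ 2 * exp (- (l * w t)) \<le> D"
    using rapid_shifted[OF l, of 2] by blast
  have "norm (nderiv n g x) * (1 + x\<^sup>2) \<le> C * D * moment l n" for n x
  proof -
    have M: "0 \<le> C * moment l n" using C(1) moment_pos[OF l, of n] by simp
    have "norm (nderiv n g x) * (1 + x\<^sup>2) \<le> (C * moment l n * exp (- (l * w \<bar>x\<bar>))) * (1 + \<bar>x\<bar>) ^ 2"
      using C M by (intro mult_mono) (auto simp: power2_sum)
    also have "\<dots> = C * moment l n * ((1 + \<bar>x\<bar>) ^ 2 * exp (- (l * w \<bar>x\<bar>)))" by simp
    also have "\<dots> \<le> C * moment l n * D" using M D by (intro mult_left_mono) auto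
    finally show ?thesis by (simp only: mult_ac)
  qed
  moreover have "0 \<le> C * D" using C(1) D(1) by simp
  ultimately show thesis using that by blast
qed

lemma ultradifferentiable_integrable:
  assumes g: "ultradifferentiable g"
  shows "integrable lborel g"
proof -
  obtain C where "\<And>n x. norm (nderiv n g x) * (1 + x\<^sup>2) \<le> C * moment 1 n"
    by (rule ultradifferentiable_decay[OF g, of 1]) (simp, rule that)
  from decay_integrable[OF _ this[of 0, simplified]] show ?thesis
    using smooth_nderiv_continuous[of g 0] g by (simp add: ultradifferentiable_def)
qed

text \<open>Up to a unimodular factor, \<open>\<xi> ^ n * fourier g \<xi>\<close> is the transform
  of \<open>nderiv n g\<close>, hence bounded by a moment for every \<open>n\<close>. The parameter
  is \<open>l + 1\<close> because the factor \<open>1 + \<bar>\<xi>\<bar>\<close> from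
  \<open>decay_from_moments\<close> consumes one unit.\<close>

lemma ultradifferentiable_fourier_decay:
  assumes g: "ultradifferentiable g" and l: "l > 0"
  shows "\<exists>B. \<forall>\<xi>. norm (fourier g \<xi>) * exp (l * w \<bar>\<xi>\<bar>) \<le> B"
proof -
  have sm: "smooth g" using g by (simp add: ultradifferentiable_def)
  have l1: "l + 1 > 0" using l by simp
  obtain C where C: "C \<ge> 0" "\<And>n x. norm (nderiv n g x) * (1 + x\<^sup>2) \<le> C * moment (l + 1) n"
    by (rule ultradifferentiable_decay[OF g l1]) (rule that)
  obtain D where D: "D > 0" "\<And>t. t \<ge> 0 \<Longrightarrow> (1 + t) ^ 1 * exp (- (1 * w t)) \<le> D"
    using rapid_shifted[of 1 1] by auto
  define b where "b = C * pi * exp ((l + 1) * w 1)"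
  have b: "b \<ge> 0" using C(1) by (simp add: b_def)
  have "norm (fourier g \<xi>) * exp (l * w \<bar>\<xi>\<bar>) \<le> b * D" for \<xi>
  proof -
    have "norm (fourier g \<xi>) * \<bar>\<xi>\<bar> ^ n \<le> C * pi * moment (l + 1) n" for n
    proof -
      have "norm (fourier g \<xi>) * \<bar>\<xi>\<bar> ^ n = norm (fourier (nderiv n g) \<xi>)"
        unfolding fourier_nderiv[OF sm C(2)] by (simp add: norm_mult norm_power)
      also have "\<dots> \<le> (\<integral>x. norm (nderiv n g x) \<partial>lborel)" by (rule norm_fourier_le)
      also have "\<dots> \<le> C * moment (l + 1) n * pi"
        by (rule decay_integral_norm[OF smooth_nderiv_continuous[OF sm] C(2)])
      finally show ?thesis by (simp only: mult_ac)
    qed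
    from decay_from_moments[OF l1 _ _ this] C(1)
    have "norm (fourier g \<xi>) \<le> b * (1 + \<bar>\<xi>\<bar>) * exp (- ((l + 1) * w \<bar>\<xi>\<bar>))" by (simp add: b_def)
    then have "norm (fourier g \<xi>) * exp (l * w \<bar>\<xi>\<bar>)
        \<le> b * (1 + \<bar>\<xi>\<bar>) * exp (- ((l + 1) * w \<bar>\<xi>\<bar>)) * exp (l * w \<bar>\<xi>\<bar>)"
      by (rule mult_right_mono) simp
    also have "\<dots> = b * ((1 + \<bar>\<xi>\<bar>) ^ 1 * exp (- (1 * w \<bar>\<xi>\<bar>)))"
      by (simp add: mult.assoc distrib_right flip: exp_add)
    also have "\<dots> \<le> b * D" using b D(2)[of "\<bar>\<xi>\<bar>"] by (intro mult_left_mono) auto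
    finally show ?thesis .
  qed
  then show ?thesis by blast
qed

lemma fourier_scale: "fourier (\<lambda>x. c * h x) \<xi> = c * fourier h \<xi>"
  unfolding fourier_def by (simp only: mult.left_commute[of _ c] integral_mult_right_zero)

lemma ultradifferentiable_gelfand_shilov:
  assumes g: "ultradifferentiable g"
  shows "g \<in> gelfand_shilov w"
proof -
  have int: "integrable lborel (\<lambda>x. x ^ k *\<^sub>R g x)" for k
    by (rule ultradifferentiable_integrable[OF ultradifferentiable_times_power[OF g]])
  have "gs_seminorm w l j g < \<infinity>" if l: "l > 0" for l j
  proof -
    obtain B1 where B1: "\<And>x. norm (nderiv j g x) * exp (l * w \<bar>x\<bar>) \<le> B1"
      using ultradifferentiable_exp_decay[OF g l] by blast
    obtain B2 where B2: "\<And>\<xi>. norm (fourier (\<lambda>x. x ^ j *\<^sub>R g x) \<xi>) * exp (l * w \<bar>\<xi>\<bar>) \<le> B2"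
      using ultradifferentiable_fourier_decay[OF ultradifferentiable_times_power[OF g] l] by blast
    have "norm (nderiv j (fourier g) \<xi>) * exp (l * w \<bar>\<xi>\<bar>) \<le> B2" for \<xi>
      unfolding nderiv_fourier[OF int] fourier_scale using B2[of \<xi>] by (simp add: norm_mult norm_power)
    then show ?thesis
      unfolding gs_seminorm_finite_iff using B1 by (intro exI[of _ "max B1 B2"]) (auto simp: le_max_iff_disj)
  qed
  then show ?thesis
    using int[of 0] smooth_fourier[OF int] g by (simp add: gelfand_shilov_def ultradifferentiable_def)
qed

text \<open>The recursion satisfied by \<open>b n k = norm (nderiv n (nderiv k f \<circ> \<psi>) x)\<close> for fixed \<open>x\<close>, which
  replaces Faa di Bruno's formula.\<close>
lemma composition_recursion:
  fixes b :: "nat \<Rightarrow> nat \<Rightarrow> real" and c :: "nat \<Rightarrow> real"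
  assumes l: "l > 0" and P: "P > 0" and C: "0 \<le> C" "0 \<le> D" "0 \<le> q" "C * q \<le> 1"
    and b: "\<And>n k. 0 \<le> b n k" and c: "\<And>j. 0 \<le> c j" "\<And>j. c j \<le> C * moment l j * P"
    and b0: "\<And>k. b 0 k * P ^ k \<le> D * q ^ k * moment l k"
    and step: "\<And>n k. b (Suc n) k \<le> (\<Sum>i\<le>n. real (n choose i) * (c (n - i) * b i (Suc k)))"
  shows "b n k * P ^ k \<le> D * 2 ^ n * q ^ k * moment l (n + k)"
proof (induction n arbitrary: k rule: less_induct)
  case (less n)
  have M: "0 < moment l j" for j using moment_pos[OF l] .
  show ?case
  proof (cases n)
    case 0
    then show ?thesis using b0[of k] by simp
  next
    case (Suc m)
    have summand: "real (m choose i) * (c (m - i) * b i (Suc k)) * P ^ k \<le> (D * q ^ k * moment l (n + k)) * 2 ^ i"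
      if i: "i \<le> m" for i
    proof -
      \<comment> \<open>Each use of the chain rule raises \<open>k\<close> by one: the factor
        \<open>P\<close> of \<open>c\<close> completes \<open>P ^ Suc k\<close>, and the additional
        \<open>q\<close> cancels \<open>C\<close>.\<close>
      have "c (m - i) * (b i (Suc k) * P ^ k) \<le> (C * moment l (m - i) * P) * (b i (Suc k) * P ^ k)"
        using b P by (intro mult_right_mono c) auto
      also have "\<dots> = C * moment l (m - i) * (b i (Suc k) * P ^ Suc k)" by simp
      also have "\<dots> \<le> C * moment l (m - i) * (D * 2 ^ i * q ^ Suc k * moment l (i + Suc k))"
        using C M[of "m - i"] i Suc by (intro mult_left_mono less.IH) auto
      also have "\<dots> = (C * q) * (D * 2 ^ i * q ^ k * (moment l (m - i) * moment l (i + Suc k)))"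
        by (simp only: power_Suc mult_ac)
      also have "\<dots> \<le> 1 * (D * 2 ^ i * q ^ k * (moment l (m - i) * moment l (i + Suc k)))"
        using C M[of "m - i"] M[of "i + Suc k"] by (intro mult_right_mono) auto
      finally have 1: "c (m - i) * (b i (Suc k) * P ^ k)
          \<le> D * 2 ^ i * q ^ k * (moment l (m - i) * moment l (i + Suc k))" by simp
      \<comment> \<open>The two indices add up to \<open>n + k\<close> with
        \<open>n = Suc m\<close>, so the binomial coefficient offered by \<open>moment_mult\<close>
        dominates that of Leibniz' rule.\<close>
      have "real (m choose i) * (moment l (m - i) * moment l (i + Suc k)) \<le> moment l (n + k)"
      proof -
        have "m choose i = m choose (m - i)" using i by (rule binomial_symmetric)
        also have "\<dots> \<le> (m - i + (i + Suc k)) choose (m - i)" using i by (intro binomial_right_mono) simp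
        finally have "real (m choose i) * (moment l (m - i) * moment l (i + Suc k))
            \<le> real ((m - i + (i + Suc k)) choose (m - i)) * (moment l (m - i) * moment l (i + Suc k))"
          using M[of "m - i"] M[of "i + Suc k"] by (intro mult_right_mono) auto
        also have "\<dots> \<le> moment l (m - i + (i + Suc k))" by (rule moment_mult[OF l])
        finally show ?thesis using i Suc by simp
      qed
      then have 2: "(D * 2 ^ i * q ^ k) * (real (m choose i) * (moment l (m - i) * moment l (i + Suc k)))
          \<le> (D * 2 ^ i * q ^ k) * moment l (n + k)"
        using C by (intro mult_left_mono) auto
      have "real (m choose i) * (c (m - i) * b i (Suc k)) * P ^ k = real (m choose i) * (c (m - i) * (b i (Suc k) * P ^ k))"
        by simp
      also have "\<dots> \<le> real (m choose i) * (D * 2 ^ i * q ^ k * (moment l (m - i) * moment l (i + Suc k)))"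
        using 1 by (intro mult_left_mono) auto
      also have "\<dots> = (D * 2 ^ i * q ^ k) * (real (m choose i) * (moment l (m - i) * moment l (i + Suc k)))"
        by (simp only: mult_ac)
      also have "\<dots> \<le> (D * 2 ^ i * q ^ k) * moment l (n + k)" by (rule 2)
      finally show ?thesis by (simp only: mult_ac)
    qed
    have "b n k * P ^ k \<le> (\<Sum>i\<le>m. real (m choose i) * (c (m - i) * b i (Suc k))) * P ^ k"
      unfolding Suc using P by (intro mult_right_mono step) auto
    also have "\<dots> = (\<Sum>i\<le>m. real (m choose i) * (c (m - i) * b i (Suc k)) * P ^ k)"
      by (rule sum_distrib_right)
    also have "\<dots> \<le> (\<Sum>i\<le>m. (D * q ^ k * moment l (n + k)) * 2 ^ i)"
      by (intro sum_mono summand) simp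
    also have "\<dots> = (D * q ^ k * moment l (n + k)) * (\<Sum>i\<le>m. 2 ^ i)" by (rule sum_distrib_left[symmetric])
    also have "\<dots> \<le> (D * q ^ k * moment l (n + k)) * 2 ^ n"
    proof (rule mult_left_mono)
      \<comment> \<open>The number of Leibniz terms is paid for by this geometric sum, which
        reproduces the factor \<open>2 ^ n\<close> of the claim.\<close>
      have "(\<Sum>i\<le>j. (2::real) ^ i) = 2 ^ Suc j - 1" for j by (induction j) auto
      then show "(\<Sum>i\<le>m. (2::real) ^ i) \<le> 2 ^ n" using Suc by simp
    qed (use C M[of "n + k"] in auto)
    finally show ?thesis by (simp only: mult_ac)
  qed
qed

end

section \<open>Weights and their roots\<close>

lemma weight_rapid:
  assumes "weight \<omega>" "l > 0"
  shows "\<exists>B. \<forall>t\<ge>0. t ^ k * exp (- (l * \<omega> t)) \<le> B"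
proof -
  have nonneg: "\<And>t. t \<ge> 0 \<Longrightarrow> 0 \<le> \<omega> t"
    and small: "(\<lambda>t. ln (1 + t\<^sup>2)) \<in> o[at_top](\<omega>)"
    using assms(1) by (auto simp: weight_def)
  \<comment> \<open>The denominator exceeds \<open>k\<close> so that \<open>k = 0\<close> is covered
    as well.\<close>
  define c where "c = l / (real k + 1)"
  have "c > 0" using assms(2) by (simp add: c_def)
  from landau_o.smallD[OF small this]
  obtain T where T: "\<And>t. t \<ge> T \<Longrightarrow> norm (ln (1 + t\<^sup>2)) \<le> c * norm (\<omega> t)"
    by (auto simp: eventually_at_top_linorder)
  define T' where "T' = max T 0"
  have "t ^ k * exp (- (l * \<omega> t)) \<le> max 1 (T' ^ k)" if t: "t \<ge> 0" for t
  proof (cases "t \<ge> T'")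
    case True
    have "real k * ln (1 + t\<^sup>2) \<le> real k * (c * \<omega> t)"
      using T[of t] True nonneg[OF t] by (intro mult_left_mono) (auto simp: T'_def)
    also have "\<dots> \<le> (real k + 1) * (c * \<omega> t)"
      using \<open>c > 0\<close> nonneg[OF t] by (intro mult_right_mono) auto
    also have "\<dots> = l * \<omega> t" by (simp add: c_def field_simps)
    finally have "exp (real k * ln (1 + t\<^sup>2)) \<le> exp (l * \<omega> t)" by simp
    moreover have "exp (real k * ln (1 + t\<^sup>2)) = (1 + t\<^sup>2) ^ k"
      using add_pos_nonneg[of 1 "t\<^sup>2"] by (simp add: exp_of_nat_mult)
    moreover have "t ^ k \<le> (1 + t\<^sup>2) ^ k"
    proof (rule power_mono[OF _ t])
      have "2 * t * 1 \<le> t\<^sup>2 + 1\<^sup>2" by (rule sum_squares_bound)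
      then show "t \<le> 1 + t\<^sup>2" using t by simp
    qed
    ultimately have "t ^ k \<le> exp (l * \<omega> t)" by simp
    then have "t ^ k * exp (- (l * \<omega> t)) \<le> exp (l * \<omega> t) * exp (- (l * \<omega> t))"
      by (rule mult_right_mono) simp
    then show ?thesis by (simp flip: exp_add)
  next
    case False
    have "t ^ k * exp (- (l * \<omega> t)) \<le> T' ^ k * 1"
      using t False assms(2) nonneg[OF t] by (intro mult_mono power_mono) (auto simp: T'_def)
    then show ?thesis by simp
  qed
  then show ?thesis by blast
qed

lemma not_set_integrable_identity_over_square:
  fixes e :: real
  assumes "e > 0"
  shows "\<not> set_integrable lborel {0..} (\<lambda>t. e * t / (1 + t\<^sup>2))"
proof
  let ?g = "\<lambda>t::real. e * t / (1 + t\<^sup>2)"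
  assume g: "set_integrable lborel {0..} ?g"
  define I where "I = (LINT t:{0..}|lborel. ?g t)"
  have bound: "e / 2 * ln (1 + b\<^sup>2) \<le> I" if b: "b \<ge> 0" for b
  proof -
    have pos: "1 + x\<^sup>2 > 0" for x :: real by (simp add: add_pos_nonneg)
    have d: "((\<lambda>x. e / 2 * ln (1 + x\<^sup>2)) has_real_derivative ?g x) (at x)" for x
      using pos[of x] by (auto intro!: derivative_eq_intros simp: field_simps)
    have c: "isCont ?g x" for x
      using pos[of x] by (intro continuous_intros) auto
    have "has_bochner_integral lborel (\<lambda>x. ?g x * indicator {0..b} x)
        (e / 2 * ln (1 + b\<^sup>2) - e / 2 * ln (1 + 0\<^sup>2))"
      by (rule has_bochner_integral_FTC_Icc_real[OF b d c])
    then have "(\<integral>x. ?g x * indicator {0..b} x \<partial>lborel) = e / 2 * ln (1 + b\<^sup>2) - e / 2 * ln (1 + 0\<^sup>2)"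
      and "integrable lborel (\<lambda>x. ?g x * indicator {0..b} x)"
      by (simp_all only: has_bochner_integral_iff)
    moreover have "(\<integral>x. ?g x * indicator {0..b} x \<partial>lborel) \<le> I"
      unfolding I_def set_lebesgue_integral_def
    proof (rule Bochner_Integration.integral_mono)
      show "integrable lborel (\<lambda>x. indicator {0..} x *\<^sub>R ?g x)"
        using g by (simp add: set_integrable_def)
      show "?g x * indicator {0..b} x \<le> indicator {0..} x *\<^sub>R ?g x" for x
        using assms pos[of x] by (auto simp: indicator_def intro!: divide_nonneg_pos)
    qed fact
    ultimately show ?thesis by simp
  qed
  have "I \<ge> 0" using bound[of 0] by simp
  \<comment> \<open>The upper limit \<open>exp (I / e + 1)\<close> is chosen so that the logarithmic
    lower bound for the integral becomes \<open>I + e\<close>.\<close>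
  have "1 + (exp (I / e + 1))\<^sup>2 \<ge> exp (2 * (I / e + 1))" unfolding exp_double by simp
  then have "ln (exp (2 * (I / e + 1))) \<le> ln (1 + (exp (I / e + 1))\<^sup>2)"
    by (subst ln_le_cancel_iff) (auto simp: add_pos_nonneg)
  then have "e / 2 * (2 * (I / e + 1)) \<le> e / 2 * ln (1 + (exp (I / e + 1))\<^sup>2)"
    using assms by (intro mult_left_mono) auto
  also have "\<dots> \<le> I" by (rule bound) simp
  finally have "e / 2 * (2 * (I / e + 1)) \<le> I" .
  moreover have "e / 2 * (2 * (I / e + 1)) = I + e" using assms by (simp add: distrib_left)
  ultimately show False using assms by simp
qed

text \<open>If \<open>\<omega> t\<^sub>0 < e * t\<^sub>0\<close> for some \<open>t\<^sub>0\<close>, subadditivity gives the bound; otherwise \<open>\<omega> t \<ge> e * t\<close>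
  throughout, against the integrability condition.\<close>
lemma subadditive_weight_sublinear:
  assumes "subadditive_weight \<omega>" "e > 0"
  shows "\<exists>B. \<forall>t\<ge>0. \<omega> t \<le> e * t + B"
proof -
  have nonneg: "\<And>t. t \<ge> 0 \<Longrightarrow> 0 \<le> \<omega> t" and mono: "mono_on {0..} \<omega>"
    and int: "set_integrable lborel {0..} (\<lambda>t. \<omega> t / (1 + t\<^sup>2))"
    and sub: "\<And>s t. s \<ge> 0 \<Longrightarrow> t \<ge> 0 \<Longrightarrow> \<omega> (s + t) \<le> \<omega> s + \<omega> t"
    using assms(1) by (auto simp: subadditive_weight_def weight_def)
  have "\<exists>t>0. \<omega> t < e * t"
  proof (rule ccontr)
    assume "\<not> (\<exists>t>0. \<omega> t < e * t)"
    then have "\<not> \<omega> t < e * t" if "t > 0" for t using that by blast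
    then have ge: "e * t \<le> \<omega> t" if "t \<ge> 0" for t
      using that nonneg[of 0] by (cases "t = 0") (auto simp: not_less)
    have "set_integrable lborel {0..} (\<lambda>t. e * t / (1 + t\<^sup>2))"
    proof (rule set_integrable_bound[OF int])
      show "set_borel_measurable lborel {0..} (\<lambda>t. e * t / (1 + t\<^sup>2))"
        unfolding set_borel_measurable_def by measurable
      show "AE t in lborel. t \<in> {0..} \<longrightarrow> norm (e * t / (1 + t\<^sup>2)) \<le> norm (\<omega> t / (1 + t\<^sup>2))"
      proof (intro AE_I2 impI)
        fix t :: real assume "t \<in> {0..}"
        then have t: "t \<ge> 0" by simp
        have "e * t / (1 + t\<^sup>2) \<le> \<omega> t / (1 + t\<^sup>2)"
          using ge[OF t] by (intro divide_right_mono) auto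
        then show "norm (e * t / (1 + t\<^sup>2)) \<le> norm (\<omega> t / (1 + t\<^sup>2))"
          using t assms(2) nonneg[OF t] by simp
      qed
    qed
    with not_set_integrable_identity_over_square[OF assms(2)] show False by contradiction
  qed
  then obtain t0 where t0: "t0 > 0" "\<omega> t0 < e * t0" by blast
  have nat: "\<omega> (real n * t0 + r) \<le> real n * \<omega> t0 + \<omega> r" if "r \<ge> 0" for n r
  proof (induction n)
    case (Suc n)
    have "\<omega> (t0 + (real n * t0 + r)) \<le> \<omega> t0 + \<omega> (real n * t0 + r)"
      using t0 that by (intro sub) auto
    with Suc show ?case by (simp add: algebra_simps)
  qed simp
  have "\<omega> t \<le> e * t + \<omega> t0" if t: "t \<ge> 0" for t
  proof -
    \<comment> \<open>Division of \<open>t\<close> by \<open>t0\<close> with remainder: each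
      multiple of \<open>t0\<close> contributes less than \<open>e * t0\<close>, the remainder at
      most \<open>\<omega> t0\<close>.\<close>
    define n where "n = nat \<lfloor>t / t0\<rfloor>"
    define r where "r = t - real n * t0"
    have fl: "real n \<le> t / t0" "t / t0 < real n + 1"
      using t t0 unfolding n_def by (auto simp: of_nat_nat)
    have r: "0 \<le> r" "r \<le> t0"
      using fl t0 by (auto simp: r_def field_simps)
    have "\<omega> t = \<omega> (real n * t0 + r)" by (simp add: r_def)
    also have "\<dots> \<le> real n * \<omega> t0 + \<omega> r" by (rule nat[OF r(1)])
    also have "\<dots> \<le> real n * (e * t0) + \<omega> t0"
      using t0 r mono by (intro add_mono mult_left_mono) (auto intro: mono_onD)
    also have "real n * (e * t0) \<le> e * t"
      using fl(1) t0 assms(2) by (simp add: field_simps)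
    finally show ?thesis by simp
  qed
  then show ?thesis by blast
qed

lemma subadditive_weight_rapid:
  assumes "subadditive_weight \<omega>"
  shows "subadditive_rapid \<omega>"
proof
  show "\<exists>B. \<forall>t\<ge>0. t ^ k * exp (- (l * \<omega> t)) \<le> B" if "l > 0" for l k
    using assms that by (intro weight_rapid) (auto simp: subadditive_weight_def)
  show "\<exists>B. \<forall>t\<ge>0. \<omega> t \<le> e * t + B" if "e > 0" for e
    using assms that by (rule subadditive_weight_sublinear)
qed (use assms in \<open>auto simp: subadditive_weight_def weight_def intro: mono_onD\<close>)

text \<open>Dividing by \<open>s + t\<close> reduces the claim to
  \<open>u \<le> u powr \<theta>\<close> on the unit interval.\<close>

lemma powr_add_le_add_powr:
  fixes s t \<theta> :: real
  assumes "0 < \<theta>" "\<theta> \<le> 1" "0 \<le> s" "0 \<le> t"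
  shows "(s + t) powr \<theta> \<le> s powr \<theta> + t powr \<theta>"
proof (cases "s + t = 0")
  case False
  then have pos: "s + t > 0" using assms by simp
  have "u \<le> u powr \<theta>" if "0 \<le> u" "u \<le> 1" for u :: real
    using powr_mono'[OF assms(2) that] that by simp
  from this[of "s / (s + t)"] this[of "t / (s + t)"]
  have "s / (s + t) + t / (s + t) \<le> (s / (s + t)) powr \<theta> + (t / (s + t)) powr \<theta>"
    using assms pos by simp
  then have "1 \<le> (s powr \<theta> + t powr \<theta>) / (s + t) powr \<theta>"
    using assms pos by (simp add: powr_divide flip: add_divide_distrib)
  then show ?thesis using pos by simp
qed (use assms in simp)

section \<open>Transfer of the estimates to the root weight\<close>

locale root_weight = subadditive_rapid \<omega> for \<omega> :: "real \<Rightarrow> real" +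
  fixes \<sigma> :: "real \<Rightarrow> real" and a :: real
  assumes a: "a \<ge> 1"
    and root: "\<And>t. t \<ge> 0 \<Longrightarrow> \<sigma> t = \<omega> (t powr (1 / a))"
begin

text \<open>Convexity is inherited by rescaling, since
  \<open>\<sigma> (exp z) = \<omega> (exp (z / a))\<close>. Subadditivity and sublinearity use that
  \<open>t powr (1 / a)\<close> is subadditive and at most \<open>1 + t\<close>.\<close>

lemma root_rapid: "subadditive_rapid \<sigma>"
proof
  show "0 \<le> \<sigma> t" if "t \<ge> 0" for t using that by (simp add: root nonneg)
  show "\<sigma> s \<le> \<sigma> t" if "0 \<le> s" "s \<le> t" for s t
    using that a by (simp add: root) (intro mono powr_mono2, auto)
  show "\<sigma> (s + t) \<le> \<sigma> s + \<sigma> t" if "0 \<le> s" "0 \<le> t" for s t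
  proof -
    have "\<sigma> (s + t) \<le> \<omega> (s powr (1 / a) + t powr (1 / a))"
      using that a by (simp add: root) (intro mono powr_add_le_add_powr, auto)
    also have "\<dots> \<le> \<sigma> s + \<sigma> t" using that by (simp add: root subadd)
    finally show ?thesis .
  qed
  show "convex_on UNIV (\<lambda>t. \<sigma> (exp t))"
  proof (rule convex_onI)
    fix t x y :: real assume t: "0 < t" "t < 1"
    have eq: "\<sigma> (exp z) = \<omega> (exp (z / a))" for z by (simp add: root exp_powr_real)
    have "\<omega> (exp ((1 - t) *\<^sub>R (x / a) + t *\<^sub>R (y / a))) \<le> (1 - t) * \<omega> (exp (x / a)) + t * \<omega> (exp (y / a))"
      using t by (intro convex_onD[OF convex]) auto
    then show "\<sigma> (exp ((1 - t) *\<^sub>R x + t *\<^sub>R y)) \<le> (1 - t) * \<sigma> (exp x) + t * \<sigma> (exp y)"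
      by (simp add: eq add_divide_distrib)
  qed simp
  show "\<exists>B. \<forall>t\<ge>0. t ^ k * exp (- (l * \<sigma> t)) \<le> B" if l: "l > 0" for l k
  proof -
    define n where "n = nat \<lceil>a\<rceil>"
    obtain B where B: "\<And>t. t \<ge> 0 \<Longrightarrow> (1 + t) ^ (n * k) * exp (- (l * \<omega> t)) \<le> B"
      using rapid_shifted[OF l] by blast
    have "t ^ k * exp (- (l * \<sigma> t)) \<le> B" if t: "t \<ge> 0" for t
    proof -
      let ?u = "t powr (1 / a)"
      have "t = ?u powr a" using t a by (simp add: powr_powr)
      also have "\<dots> \<le> (1 + ?u) powr a" using a by (intro powr_mono2) auto
      also have "\<dots> \<le> (1 + ?u) powr (real n)" using a by (intro powr_mono) (auto simp: n_def)
      also have "\<dots> = (1 + ?u) ^ n" by (rule powr_realpow) (simp add: add_pos_nonneg)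
      finally have "t ^ k \<le> ((1 + ?u) ^ n) ^ k" using t by (intro power_mono)
      then have "t ^ k * exp (- (l * \<sigma> t)) \<le> (1 + ?u) ^ (n * k) * exp (- (l * \<omega> ?u))"
        using t by (simp add: root power_mult)
      also have "\<dots> \<le> B" by (rule B) simp
      finally show ?thesis .
    qed
    then show ?thesis by blast
  qed
  show "\<exists>B. \<forall>t\<ge>0. \<sigma> t \<le> e * t + B" if e: "e > 0" for e
  proof -
    obtain B where B: "\<And>t. t \<ge> 0 \<Longrightarrow> \<omega> t \<le> e * t + B" using sublinear[OF e] by blast
    have "\<sigma> t \<le> e * t + (e + B)" if t: "t \<ge> 0" for t
    proof -
      have "t powr (1 / a) \<le> (1 + t) powr (1 / a)" using t a by (intro powr_mono2) auto
      also have "\<dots> \<le> (1 + t) powr 1" using t a by (intro powr_mono) auto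
      finally have "e * t powr (1 / a) \<le> e * (1 + t)" using t e by (intro mult_left_mono) auto
      with B[of "t powr (1 / a)"] show ?thesis using t by (simp add: root distrib_left)
    qed
    then show ?thesis by blast
  qed
qed

sublocale \<sigma>: subadditive_rapid \<sigma> by (rule root_rapid)

text \<open>With \<open>m = max t v\<close> the powers combine to at most
  \<open>(m powr a) ^ k\<close>, the exponentials to at most
  \<open>exp (- (l * \<omega> m))\<close>, and
  \<open>\<omega> m = \<sigma> (m powr a)\<close>.\<close>

lemma moment_root:
  assumes l: "l > 0" and v: "v \<ge> 1"
  shows "v powr ((a - 1) * real k) * exp (- (l * \<omega> v)) * moment l k \<le> \<sigma>.moment l k"
proof (rule moment_least_scaled)
  show "0 \<le> \<sigma>.moment l k" using \<sigma>.moment_pos[OF l] by (rule less_imp_le)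
  fix t :: real assume t: "t \<ge> 0"
  define m where "m = max t v"
  have m: "m \<ge> 1" "t \<le> m" "v \<le> m" using v by (auto simp: m_def)
  have exp: "exp (- (l * \<omega> v)) * exp (- (l * \<omega> t)) \<le> exp (- (l * \<omega> m))"
  proof -
    have "\<omega> m \<le> \<omega> v + \<omega> t"
      using nonneg[OF t] nonneg[of v] v by (auto simp: m_def max_def)
    then have "l * \<omega> m \<le> l * (\<omega> v + \<omega> t)" using l by (intro mult_left_mono) auto
    then show ?thesis by (simp add: distrib_left flip: exp_add)
  qed
  have "v powr ((a - 1) * real k) * t ^ k \<le> m powr ((a - 1) * real k) * m ^ k"
    using m t v a by (intro mult_mono powr_mono2 power_mono) auto
  also have "\<dots> = m powr ((a - 1) * real k) * m powr real k" using m by (simp add: powr_realpow)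
  also have "\<dots> = m powr (a * real k)" by (simp add: algebra_simps flip: powr_add)
  also have "\<dots> = (m powr a) ^ k" using m by (simp add: powr_power mult.commute)
  finally have pow: "v powr ((a - 1) * real k) * t ^ k \<le> (m powr a) ^ k" .
  have "v powr ((a - 1) * real k) * exp (- (l * \<omega> v)) * (t ^ k * exp (- (l * \<omega> t)))
      = (v powr ((a - 1) * real k) * t ^ k) * (exp (- (l * \<omega> v)) * exp (- (l * \<omega> t)))"
    by (simp only: mult_ac)
  also have "\<dots> \<le> (m powr a) ^ k * exp (- (l * \<omega> m))"
    by (intro mult_mono pow exp) auto
  also have "\<dots> = (m powr a) ^ k * exp (- (l * \<sigma> (m powr a)))"
    using m a by (simp add: root powr_powr)
  also have "\<dots> \<le> \<sigma>.moment l k" using l by (intro \<sigma>.moment_upper) auto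
  finally show "v powr ((a - 1) * real k) * exp (- (l * \<omega> v)) * (t ^ k * exp (- (l * \<omega> t))) \<le> \<sigma>.moment l k" .
qed simp

text \<open>The arbitrary factor \<open>n ^ k\<close> on the left absorbs the constants \<open>C\<^sub>m\<close> of the inner function.\<close>
lemma gelfand_shilov_root_estimate:
  assumes f: "f \<in> gelfand_shilov \<omega>" and l: "l > 0" and n: "n \<ge> 1"
  obtains D where "D \<ge> 0"
    "\<And>k y. real n ^ k * norm (nderiv k f y) * ((1 + \<bar>y\<bar>) powr (a - 1)) ^ k
      \<le> D * \<sigma>.moment l k * exp (- (l * \<omega> \<bar>y\<bar>))"
proof -
  \<comment> \<open>The factor \<open>n\<close> of the parameter pays for \<open>n ^ k\<close>. Of
    the decay at rate \<open>2 * l\<close>, one half is used in \<open>moment_root\<close> at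
    \<open>1 + \<bar>y\<bar>\<close>, the other survives in the conclusion.\<close>
  have pos: "2 * l > 0" "real n * (2 * l) > 0" using l n by auto
  obtain C where C: "C \<ge> 0" "\<And>k x. norm (nderiv k f x)
      \<le> C * moment (real n * (2 * l)) k * exp (- (real n * (2 * l) * \<omega> \<bar>x\<bar>))"
    by (rule gelfand_shilov_mixed_estimate[OF f pos(2)]) (rule that)
  have "real n ^ k * norm (nderiv k f y) * ((1 + \<bar>y\<bar>) powr (a - 1)) ^ k
      \<le> (C * exp (l * \<omega> 1)) * \<sigma>.moment l k * exp (- (l * \<omega> \<bar>y\<bar>))" for k y
  proof -
    define v where "v = 1 + \<bar>y\<bar>"
    have v: "v \<ge> 1" by (simp add: v_def)
    have vk: "(v powr (a - 1)) ^ k = v powr ((a - 1) * real k)"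
      using v by (simp add: powr_power mult.commute)
    have e: "exp (- (real n * (2 * l) * \<omega> \<bar>y\<bar>)) \<le> exp (l * \<omega> 1) * exp (- (l * \<omega> v)) * exp (- (l * \<omega> \<bar>y\<bar>))"
    proof -
      have "l * \<omega> v \<le> l * (\<omega> 1 + \<omega> \<bar>y\<bar>)"
        unfolding v_def using l by (intro mult_left_mono subadd) auto
      moreover have "1 * (2 * l * \<omega> \<bar>y\<bar>) \<le> real n * (2 * l * \<omega> \<bar>y\<bar>)"
        using n l nonneg[of "\<bar>y\<bar>"] by (intro mult_right_mono) auto
      ultimately show ?thesis by (simp add: algebra_simps flip: exp_add)
    qed
    have Cm: "0 \<le> C * moment l k" using C(1) moment_pos[OF l, of k] by simp
    have "real n ^ k * norm (nderiv k f y)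
        \<le> real n ^ k * (C * moment (real n * (2 * l)) k * exp (- (real n * (2 * l) * \<omega> \<bar>y\<bar>)))"
      by (intro mult_left_mono C) simp
    also have "\<dots> = C * (real n ^ k * moment (real n * (2 * l)) k) * exp (- (real n * (2 * l) * \<omega> \<bar>y\<bar>))"
      by (simp only: mult_ac)
    also have "\<dots> \<le> C * moment (2 * l) k * exp (- (real n * (2 * l) * \<omega> \<bar>y\<bar>))"
      using C(1) n l by (intro mult_right_mono mult_left_mono moment_scale) auto
    also have "\<dots> \<le> C * moment l k * exp (- (real n * (2 * l) * \<omega> \<bar>y\<bar>))"
      using C(1) l by (intro mult_right_mono mult_left_mono moment_anti) auto
    also have "\<dots> \<le> C * moment l k * (exp (l * \<omega> 1) * exp (- (l * \<omega> v)) * exp (- (l * \<omega> \<bar>y\<bar>)))"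
      by (rule mult_left_mono[OF e Cm])
    finally have "real n ^ k * norm (nderiv k f y) * (v powr (a - 1)) ^ k
        \<le> C * moment l k * (exp (l * \<omega> 1) * exp (- (l * \<omega> v)) * exp (- (l * \<omega> \<bar>y\<bar>))) * v powr ((a - 1) * real k)"
      unfolding vk by (rule mult_right_mono) simp
    also have "\<dots> = (C * exp (l * \<omega> 1)) * (v powr ((a - 1) * real k) * exp (- (l * \<omega> v)) * moment l k) * exp (- (l * \<omega> \<bar>y\<bar>))"
      by (simp only: mult_ac)
    also have "\<dots> \<le> (C * exp (l * \<omega> 1)) * \<sigma>.moment l k * exp (- (l * \<omega> \<bar>y\<bar>))"
      using C(1) by (intro mult_right_mono mult_left_mono moment_root l v) auto
    finally show ?thesis unfolding v_def .
  qed
  moreover have "0 \<le> C * exp (l * \<omega> 1)" using C(1) by simp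
  ultimately show thesis using that by blast
qed

text \<open>Taking roots in the growth condition converts decay in \<open>\<psi> x\<close>, which is
  what the estimates of \<open>f\<close> provide, into decay in \<open>x\<close>.\<close>

lemma root_le_of_growth:
  assumes C0: "C0 > 0" and x: "\<bar>x\<bar> \<le> C0 * (1 + y) powr a" and y: "y \<ge> 0"
    and n: "n \<ge> 1" "C0 powr (1 / a) \<le> real n"
  shows "\<sigma> \<bar>x\<bar> \<le> real n * (\<omega> 1 + \<omega> y)"
proof -
  have "\<bar>x\<bar> powr (1 / a) \<le> (C0 * (1 + y) powr a) powr (1 / a)"
    using x a by (intro powr_mono2) auto
  also have "\<dots> = C0 powr (1 / a) * (1 + y)" using C0 y a by (simp add: powr_mult powr_powr)
  also have "\<dots> \<le> real n * (1 + y)" using n y by (intro mult_right_mono) auto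
  finally have "\<sigma> \<bar>x\<bar> \<le> \<omega> (real n * (1 + y))" using y by (simp add: root mono)
  also have "\<dots> \<le> real n * \<omega> (1 + y)" using y n by (intro subadd_nat) auto
  also have "\<dots> \<le> real n * (\<omega> 1 + \<omega> y)" using y by (intro mult_left_mono subadd) auto
  finally show ?thesis .
qed

end

text \<open>With \<open>u = exp t\<close>, \<open>m\<close> times the expression maximised in the
  Young conjugate is the logarithm of the one maximised in \<open>moment\<close>, restricted to
  \<open>u \<ge> 1\<close>.\<close>

lemma (in subadditive_rapid) exp_young_conj_le_moment:
  assumes m: "m \<ge> 1"
  shows "exp (real m * young_conj w (real j / real m)) \<le> moment (real m) j"
proof -
  have pos: "real m > 0" using m by simp
  have "young_conj w (real j / real m) \<le> ln (moment (real m) j) / real m"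
    unfolding young_conj_def
  proof (rule cSUP_least)
    fix t :: real
    have "exp (real j * t - real m * w (exp t)) = (exp t) ^ j * exp (- (real m * w (exp t)))"
      by (simp add: exp_diff exp_minus exp_of_nat_mult divide_inverse)
    also have "\<dots> \<le> moment (real m) j" using pos by (intro moment_upper) auto
    finally have "real j * t - real m * w (exp t) \<le> ln (moment (real m) j)"
      using moment_pos[OF pos, of j] by (simp add: ln_ge_iff)
    then have "(real j * t - real m * w (exp t)) / real m \<le> ln (moment (real m) j) / real m"
      using pos by (intro divide_right_mono) auto
    then show "real j / real m * t - w (exp t) \<le> ln (moment (real m) j) / real m"
      using m by (simp add: diff_divide_distrib)
  qed simp
  then have "real m * young_conj w (real j / real m) \<le> ln (moment (real m) j)"
    using pos by (simp add: field_simps)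
  then show ?thesis using moment_pos[OF pos, of j] by (simp add: ln_ge_iff)
qed

theorem proposition4p1:
  fixes \<omega> \<sigma> :: "real \<Rightarrow> real" and a p :: real and \<psi> :: "real \<Rightarrow> real"
  assumes "subadditive_weight \<omega>"
    and "a \<ge> 1"
    and "p = a - 1"
    and "\<And>t. t \<ge> 0 \<Longrightarrow> \<sigma> t = \<omega> (t powr (1 / a))"
    and "smooth \<psi>"
    and "\<exists>C\<^sub>0>0. \<forall>x. \<bar>x\<bar> \<le> C\<^sub>0 * (1 + \<bar>\<psi> x\<bar>) powr a"
    and "\<And>m::nat. m \<ge> 1 \<Longrightarrow>
           \<exists>C>0. \<forall>j\<ge>1. \<forall>x.
             \<bar>nderiv j \<psi> x\<bar> \<le> C * exp (m * young_conj \<sigma> (j / m)) * (1 + \<bar>\<psi> x\<bar>) powr p"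
  shows "\<forall>f\<in>gelfand_shilov \<omega>. f \<circ> \<psi> \<in> gelfand_shilov \<sigma>"
proof
  fix f assume f: "f \<in> gelfand_shilov \<omega>"
  interpret root_weight \<omega> \<sigma> a
    using assms(2,4) subadditive_weight_rapid[OF assms(1)]
    by (simp add: root_weight_def root_weight_axioms_def)
  have smf: "smooth f" using f by (simp add: gelfand_shilov_def)
  obtain C0 where C0: "C0 > 0" "\<And>x. \<bar>x\<bar> \<le> C0 * (1 + \<bar>\<psi> x\<bar>) powr a" using assms(6) by blast
  define L where "L = nat \<lceil>C0 powr (1 / a)\<rceil> + 1"
  have L: "L \<ge> 1" "C0 powr (1 / a) \<le> real L" unfolding L_def by linarith+
  have psi: "\<exists>C\<ge>0. \<forall>j x. \<bar>nderiv (Suc j) \<psi> x\<bar> \<le> C * \<sigma>.moment l j * (1 + \<bar>\<psi> x\<bar>) powr p" if l: "l > 0" for l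
  proof -
    \<comment> \<open>One unit of the parameter is reserved for lowering the index from
      \<open>Suc j\<close> to \<open>j\<close>, as the recursion counts the derivatives of \<psi>
      from the first one on.\<close>
    define m where "m = nat \<lceil>1 + l\<rceil>"
    have m: "m \<ge> 1" "1 + l \<le> real m" using l unfolding m_def by linarith+
    obtain C where C: "C > 0" "\<And>j x. j \<ge> 1 \<Longrightarrow>
        \<bar>nderiv j \<psi> x\<bar> \<le> C * exp (m * young_conj \<sigma> (j / m)) * (1 + \<bar>\<psi> x\<bar>) powr p"
      using assms(7)[OF m(1)] by blast
    have "\<bar>nderiv (Suc j) \<psi> x\<bar> \<le> (C * \<sigma>.moment 1 1) * \<sigma>.moment l j * (1 + \<bar>\<psi> x\<bar>) powr p" for j x
    proof -
      have "exp (m * young_conj \<sigma> (Suc j / m)) \<le> \<sigma>.moment (real m) (Suc j)"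
        by (rule \<sigma>.exp_young_conj_le_moment[OF m(1)])
      also have "\<dots> \<le> \<sigma>.moment (1 + l) (Suc j)" using m l by (intro \<sigma>.moment_anti) auto
      also have "\<dots> \<le> \<sigma>.moment 1 1 * \<sigma>.moment l j" using l by (intro \<sigma>.moment_shift) auto
      finally have "C * exp (m * young_conj \<sigma> (Suc j / m)) * (1 + \<bar>\<psi> x\<bar>) powr p
          \<le> C * (\<sigma>.moment 1 1 * \<sigma>.moment l j) * (1 + \<bar>\<psi> x\<bar>) powr p"
        using C(1) by (intro mult_right_mono mult_left_mono) auto
      moreover have "\<bar>nderiv (Suc j) \<psi> x\<bar> \<le> C * exp (m * young_conj \<sigma> (Suc j / m)) * (1 + \<bar>\<psi> x\<bar>) powr p"
        by (rule C(2)) simp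
      ultimately show ?thesis by (simp only: mult.assoc)
    qed
    moreover have "0 \<le> C * \<sigma>.moment 1 1" using C(1) \<sigma>.moment_pos[of 1 1] by simp
    ultimately show ?thesis by blast
  qed
  have "\<exists>C\<ge>0. \<forall>n x. norm (nderiv n (f \<circ> \<psi>) x) \<le> C * \<sigma>.moment l n * exp (- (l * \<sigma> \<bar>x\<bar>))"
    if l: "l > 0" for l
  proof -
    \<comment> \<open>The 2 absorbs the factor \<open>2 ^ n\<close> of the recursion;
      \<open>L\<close> is the loss in passing from decay in \<open>\<psi> x\<close> to decay in
      \<open>x\<close>.\<close>
    define v where "v = 2 * (real L * l)"
    have Ll: "l \<le> real L * l" "0 < real L * l" using L l by (auto simp: mult_le_cancel_right1)
    have v: "v > 0" using Ll by (simp add: v_def)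
    obtain C where C: "C \<ge> 0" "\<And>j x. \<bar>nderiv (Suc j) \<psi> x\<bar> \<le> C * \<sigma>.moment v j * (1 + \<bar>\<psi> x\<bar>) powr p"
      using psi[OF v] by blast
    \<comment> \<open>The order of the choices matters: \<open>l\<close> determines
      \<open>v\<close>, then \<open>v\<close> determines \<open>C\<close> and \<open>C\<close>
      determines \<open>n0\<close>; only now is \<open>f\<close> estimated, with \<open>D\<close>
      depending on \<open>n0\<close>. Thus \<open>q = 1 / n0\<close> cancels \<open>C\<close> at
      each step of the recursion.\<close>
    define n0 where "n0 = nat \<lceil>C\<rceil> + 1"
    have n0: "n0 \<ge> 1" "C \<le> real n0" unfolding n0_def by linarith+
    obtain D where D: "D \<ge> 0" "\<And>k y. real n0 ^ k * norm (nderiv k f y) * ((1 + \<bar>y\<bar>) powr (a - 1)) ^ k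
        \<le> D * \<sigma>.moment v k * exp (- (v * \<omega> \<bar>y\<bar>))"
      by (rule gelfand_shilov_root_estimate[OF f v n0(1)]) (rule that)
    have "norm (nderiv n (f \<circ> \<psi>) x) \<le> (D * exp (real L * l * \<omega> 1)) * \<sigma>.moment l n * exp (- (l * \<sigma> \<bar>x\<bar>))" for n x
    proof -
      define P where "P = (1 + \<bar>\<psi> x\<bar>) powr p"
      have P: "P > 0" by (simp add: P_def add_pos_nonneg)
      define E where "E = exp (- (v * \<omega> \<bar>\<psi> x\<bar>))"
      have "norm (nderiv n (nderiv 0 f \<circ> \<psi>) x) * P ^ 0 \<le> (D * E) * 2 ^ n * (1 / real n0) ^ 0 * \<sigma>.moment v (n + 0)"
      proof (rule \<sigma>.composition_recursion[where c = "\<lambda>j. \<bar>nderiv (Suc j) \<psi> x\<bar>" and C = C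
            and b = "\<lambda>n k. norm (nderiv n (nderiv k f \<circ> \<psi>) x)"])
        show "C * (1 / real n0) \<le> 1" using n0 by simp
        show "\<bar>nderiv (Suc j) \<psi> x\<bar> \<le> C * \<sigma>.moment v j * P" for j using C(2) by (simp add: P_def)
        show "norm (nderiv 0 (nderiv k f \<circ> \<psi>) x) * P ^ k \<le> D * E * (1 / real n0) ^ k * \<sigma>.moment v k" for k
          using D(2)[of k "\<psi> x"] n0 by (simp add: P_def E_def assms(3) power_one_over field_simps)
        show "norm (nderiv (Suc n) (nderiv k f \<circ> \<psi>) x)
            \<le> (\<Sum>i\<le>n. real (n choose i) * (\<bar>nderiv (Suc (n - i)) \<psi> x\<bar> * norm (nderiv i (nderiv (Suc k) f \<circ> \<psi>) x)))" for n k
        proof -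
          have "nderiv 1 (nderiv k f) = nderiv (Suc k) f" by (simp add: nderiv_nderiv)
          then show ?thesis
            unfolding nderiv_Suc_compose[OF assms(5) smooth_nderiv[OF smf]]
            by (intro order_trans[OF norm_sum] sum_mono) (simp add: abs_mult)
        qed
      qed (use v P C D n0 in \<open>auto simp: E_def\<close>)
      then have "norm (nderiv n (f \<circ> \<psi>) x) \<le> D * E * (2 ^ n * \<sigma>.moment v n)" by simp
      also have "\<dots> \<le> D * E * \<sigma>.moment l n"
      proof (rule mult_left_mono)
        have "2 ^ n * \<sigma>.moment v n \<le> \<sigma>.moment (real L * l) n"
          using \<sigma>.moment_scale[OF Ll(2), of 2 n] by (simp add: v_def)
        also have "\<dots> \<le> \<sigma>.moment l n" using Ll l by (intro \<sigma>.moment_anti)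
        finally show "2 ^ n * \<sigma>.moment v n \<le> \<sigma>.moment l n" .
      qed (use D in \<open>simp add: E_def\<close>)
      also have "\<dots> \<le> D * (exp (real L * l * \<omega> 1) * exp (- (l * \<sigma> \<bar>x\<bar>))) * \<sigma>.moment l n"
      proof (intro mult_right_mono mult_left_mono D)
        have "l * \<sigma> \<bar>x\<bar> \<le> l * (real L * (\<omega> 1 + \<omega> \<bar>\<psi> x\<bar>))"
          using l by (intro mult_left_mono root_le_of_growth[OF C0(1) C0(2) _ L]) auto
        also have "\<dots> = real L * l * \<omega> 1 + real L * l * \<omega> \<bar>\<psi> x\<bar>" by (simp add: algebra_simps)
        also have "real L * l * \<omega> \<bar>\<psi> x\<bar> \<le> v * \<omega> \<bar>\<psi> x\<bar>"
          unfolding v_def using Ll nonneg[of "\<bar>\<psi> x\<bar>"] by (intro mult_right_mono; linarith)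
        finally show "E \<le> exp (real L * l * \<omega> 1) * exp (- (l * \<sigma> \<bar>x\<bar>))"
          unfolding E_def by (simp flip: exp_add)
      qed (use \<sigma>.moment_pos[OF l, of n] in simp)
      finally show ?thesis by (simp only: mult_ac)
    qed
    moreover have "0 \<le> D * exp (real L * l * \<omega> 1)" using D(1) by simp
    ultimately show ?thesis by blast
  qed
  then have "\<sigma>.ultradifferentiable (f \<circ> \<psi>)"
    unfolding \<sigma>.ultradifferentiable_def using smooth_compose[OF assms(5) smf] by blast
  then show "f \<circ> \<psi> \<in> gelfand_shilov \<sigma>" by (rule \<sigma>.ultradifferentiable_gelfand_shilov)
qed

end
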